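(* Let $n\ge 1$, let $P$ be a finite partially ordered set, let $R$ be a partially ordered set, and let $\phi:[n]\times P\to R$ be an isotone map with left strict chain fibers. Let $\mathcal J$ be a poset ideal in $\mathrm{Hom}(P,[n])$. Let $\phi_1:\langle x_{[n]\times P}\rangle\to\langle x_R\rangle$ be the linear map with $x_{i,p}\mapsto x_{\phi(i,p)}$, and let $B$ be a basis of $\ker\phi_1$ consisting of differences $x_{i,p}-x_{i',p'}$ with $\phi(i,p)=\phi(i',p')$. Then $B$ is a regular sequence for the ring $\Bbbk[x_{[n]\times P}]/L(n,P;\mathcal J)$.
   Context: $\Bbbk$ is a field and $[n]=\{1<2<\cdots<n\}$ is the chain on $n$ elements. For a set $A$, $\Bbbk[x_A]$ is the polynomial ring in variables $x_a$, $a\in A$, and $\langle x_A\rangle$ is the $\Bbbk$-vector space spanned by these variables. A map of posets is isotone if it is order preserving; $\mathrm{Hom}(P,[n])$ is the set of isotone maps $P\to[n]$, partially ordered by $\phi\le\phi'$ iff $\phi(p)\le\phi'(p)$ for all $p$. A poset ideal of a poset is a subset $J$ such that $q\in J$ and $p\le q$ imply $p\in J$. Products of posets carry the componentwise order, and $P^{op}$ is the opposite poset of $P$. The Alexander dual of a squarefree monomial ideal $I\subseteq\Bbbk[x_A]$ is the monomial ideal of $\Bbbk[x_A]$ whose monomials are those having a nontrivial common divisor with every monomial in $I$. The co-letterplace ideal $L(P,n;\mathcal J)\subseteq\Bbbk[x_{P\times[n]}]$ is generated by all monomials $\prod_{p\in P}x_{p,\phi(p)}$ with $\phi\in\mathcal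 J$. The ideal $L(n,P;\mathcal J)\subseteq\Bbbk[x_{[n]\times P}]$ is its Alexander dual, where $\Bbbk[x_{P\times[n]}]$ and $\Bbbk[x_{[n]\times P}]$ are identified by switching coordinates $x_{p,i}\leftrightarrow x_{i,p}$. A chain in a product of posets $Q\times Q'$ is left strict if for any two of its elements, $(a,b)<(a',b')$ implies $a<a'$. An isotone map $\phi:[n]\times P\to R$ has left strict chain fibers if every fiber $\phi^{-1}(r)$ is a left strict chain in $[n]\times P^{op}$. A sequence of elements is regular for a ring if each element is a nonzerodivisor on the quotient of the ring by the preceding elements (the elements here are homogeneous of degree one, so the quotient of a nonzero graded quotient ring by them is automatically nonzero). *)

theory Defs
  imports Complex_Main "HOL-Library.Poly_Mapping" "HOL-Library.FuncSet" "HOL-Algebra.QuotRing"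
begin

section \<open>Polynomial rings in a set of variables\<close>

text \<open>
  A monomial is an exponent vector \<open>'v \<Rightarrow>\<^sub>0 nat\<close>; a polynomial is a finitely
  supported coefficient function on monomials, multiplied by convolution.
\<close>

type_synonym ('v, 'k) mpol = "('v \<Rightarrow>\<^sub>0 nat) \<Rightarrow>\<^sub>0 'k"

definition monomial_poly :: "('v \<Rightarrow>\<^sub>0 nat) \<Rightarrow> ('v, 'k::comm_ring_1) mpol" where
  "monomial_poly m = Poly_Mapping.single m 1"

definition var :: "'v \<Rightarrow> ('v, 'k::comm_ring_1) mpol" where
  "var a = monomial_poly (Poly_Mapping.single a 1)"

definition monomials_in :: "'v set \<Rightarrow> ('v \<Rightarrow>\<^sub>0 nat) set" where
  "monomials_in A = {m. Poly_Mapping.keys m \<subseteq> A}"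

definition poly_ring :: "'v set \<Rightarrow> ('v, 'k::comm_ring_1) mpol ring" where
  "poly_ring A = \<lparr>carrier = {f. Poly_Mapping.keys f \<subseteq> monomials_in A},
     mult = (*), one = 1, zero = 0, add = (+)\<rparr>"

lemma poly_ring_simps [simp]:
  "carrier (poly_ring A) = {f. Poly_Mapping.keys f \<subseteq> monomials_in A}"
  "f \<otimes>\<^bsub>poly_ring A\<^esub> g = f * g" "f \<oplus>\<^bsub>poly_ring A\<^esub> g = f + g"
  "\<one>\<^bsub>poly_ring A\<^esub> = 1" "\<zero>\<^bsub>poly_ring A\<^esub> = 0"
  by (simp_all add: poly_ring_def)

lemma monomials_in_add:
  "m \<in> monomials_in A \<Longrightarrow> m' \<in> monomials_in A \<Longrightarrow> m + m' \<in> monomials_in A"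
  unfolding monomials_in_def using Poly_Mapping.keys_add[of m m'] by blast

lemma poly_ring_mult_closed:
  assumes "Poly_Mapping.keys f \<subseteq> monomials_in A" "Poly_Mapping.keys g \<subseteq> monomials_in A"
  shows "Poly_Mapping.keys (f * g) \<subseteq> monomials_in A"
  using Poly_Mapping.keys_mult[of f g] assms monomials_in_add[of _ A] by blast

lemma poly_ring_cring: "cring (poly_ring A :: ('v, 'k::comm_ring_1) mpol ring)"
proof (rule cringI)
  show "abelian_group (poly_ring A :: ('v, 'k) mpol ring)"
  proof (rule abelian_groupI)
    fix f g :: "('v, 'k) mpol"
    assume "f \<in> carrier (poly_ring A)" "g \<in> carrier (poly_ring A)"
    then show "f \<oplus>\<^bsub>poly_ring A\<^esub> g \<in> carrier (poly_ring A)"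
      using Poly_Mapping.keys_add[of f g] by auto
  next
    fix f :: "('v, 'k) mpol"
    assume "f \<in> carrier (poly_ring A)"
    then show "\<exists>g\<in>carrier (poly_ring A). g \<oplus>\<^bsub>poly_ring A\<^esub> f = \<zero>\<^bsub>poly_ring A\<^esub>"
      by (intro bexI[of _ "- f"]) auto
  qed (simp_all add: ac_simps)
  show "comm_monoid (poly_ring A :: ('v, 'k) mpol ring)"
  proof (rule comm_monoidI)
    fix f g :: "('v, 'k) mpol"
    assume "f \<in> carrier (poly_ring A)" "g \<in> carrier (poly_ring A)"
    then show "f \<otimes>\<^bsub>poly_ring A\<^esub> g \<in> carrier (poly_ring A)"
      using poly_ring_mult_closed[of f A g] by simp
  qed (auto simp: ac_simps monomials_in_def)
qed (auto simp: algebra_simps)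

section \<open>The vector space of linear forms\<close>

definition scale :: "'k::comm_ring_1 \<Rightarrow> ('v, 'k) mpol \<Rightarrow> ('v, 'k) mpol" where
  "scale c = Poly_Mapping.map ((*) c)"

lemma lookup_scale: "Poly_Mapping.lookup (scale c f) m = c * Poly_Mapping.lookup f m"
  by (simp add: scale_def Poly_Mapping.map.rep_eq when_def)

global_interpretation pol: vector_space "scale :: 'k::field \<Rightarrow> ('v, 'k) mpol \<Rightarrow> _"
  by unfold_locales (auto intro!: poly_mapping_eqI simp: lookup_scale lookup_add algebra_simps)

definition linear_forms :: "'v set \<Rightarrow> ('v, 'k::field) mpol set" where
  "linear_forms A = pol.span (var ` A)"

text \<open>
  For finite \<open>A\<close>, the linear map \<open>linear_forms A \<rightarrow> linear_forms R\<close> with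
  \<open>var a \<mapsto> var (\<phi> a)\<close>; values outside \<open>linear_forms A\<close> carry no meaning.
\<close>

definition induced_linear :: "'v set \<Rightarrow> ('v \<Rightarrow> 'w) \<Rightarrow> ('v, 'k::field) mpol \<Rightarrow> ('w, 'k) mpol" where
  "induced_linear A \<phi> f =
     (\<Sum>a\<in>A. scale (Poly_Mapping.lookup f (Poly_Mapping.single a 1)) (var (\<phi> a)))"

lemma linear_induced_linear:
  "Vector_Spaces.linear scale scale (induced_linear A \<phi> :: ('v, 'k::field) mpol \<Rightarrow> ('w, 'k) mpol)"
  by unfold_locales
     (simp_all add: induced_linear_def lookup_scale lookup_add pol.scale_left_distrib
        sum.distrib pol.scale_sum_right)

lemma induced_linear_var:
  assumes "finite A" "a \<in> A"
  shows "induced_linear A \<phi> (var a :: ('v, 'k::field) mpol) = var (\<phi> a)"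
proof -
  have *: "Poly_Mapping.lookup (var a :: ('v, 'k) mpol) (Poly_Mapping.single b 1)
      = (if a = b then 1 else 0)" for b
  proof -
    have "Poly_Mapping.single a (1::nat) = Poly_Mapping.single b 1 \<longleftrightarrow> a = b"
      by (metis lookup_single_eq lookup_single_not_eq one_neq_zero)
    then show ?thesis
      by (simp only: var_def monomial_poly_def lookup_single when_def)
  qed
  have "induced_linear A \<phi> (var a :: ('v, 'k) mpol)
      = (\<Sum>b\<in>A. if a = b then var (\<phi> b) else 0)"
    unfolding induced_linear_def by (intro sum.cong) (simp_all only: *, auto)
  then show ?thesis
    using assms by simp
qed

lemma induced_linear_in_linear_forms:
  "\<phi> \<in> A \<rightarrow> R \<Longrightarrow> induced_linear A \<phi> f \<in> linear_forms R"
  unfolding induced_linear_def linear_forms_def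
  by (intro pol.span_sum pol.span_scale pol.span_base) auto

definition ker_linear :: "'v set \<Rightarrow> ('v \<Rightarrow> 'w) \<Rightarrow> ('v, 'k::field) mpol set" where
  "ker_linear A \<phi> = {f \<in> linear_forms A. induced_linear A \<phi> f = 0}"

section \<open>Alexander duals, letterplace and co-letterplace ideals\<close>

text \<open>
  A common divisor is taken among monomials; it is nontrivial when its exponent vector is nonzero.
\<close>

definition alexander_dual :: "'v set \<Rightarrow> ('v, 'k::field) mpol set \<Rightarrow> ('v, 'k) mpol set" where
  "alexander_dual A I = Idl\<^bsub>poly_ring A\<^esub>
     {monomial_poly m | m. m \<in> monomials_in A \<and>
        (\<forall>u. (monomial_poly u :: ('v, 'k) mpol) \<in> I \<longrightarrow>
           (\<exists>d. d \<noteq> 0 \<and> (monomial_poly d :: ('v, 'k) mpol) dvd monomial_poly m \<and>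
                (monomial_poly d :: ('v, 'k) mpol) dvd monomial_poly u))}"

text \<open>
  \<open>Hom_poset P n\<close> is the set of isotone maps from \<open>P\<close> to the chain \<open>{1..n}\<close>; they are made
  extensional (\<open>undefined\<close> off \<open>P\<close>) so that each map is represented by exactly one function.
\<close>

definition Hom_poset :: "'p::order set \<Rightarrow> nat \<Rightarrow> ('p \<Rightarrow> nat) set" where
  "Hom_poset P n = {\<psi> \<in> P \<rightarrow>\<^sub>E {1..n}. monotone_on P (\<le>) (\<le>) \<psi>}"

definition poset_ideal :: "'a set \<Rightarrow> ('a \<Rightarrow> 'a \<Rightarrow> bool) \<Rightarrow> 'a set \<Rightarrow> bool" where
  "poset_ideal Q leQ J \<longleftrightarrow> J \<subseteq> Q \<and> (\<forall>q\<in>J. \<forall>p\<in>Q. leQ p q \<longrightarrow> p \<in> J)"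

definition le_on :: "'p set \<Rightarrow> ('p \<Rightarrow> nat) \<Rightarrow> ('p \<Rightarrow> nat) \<Rightarrow> bool" where
  "le_on P \<psi> \<psi>' \<longleftrightarrow> (\<forall>p\<in>P. \<psi> p \<le> \<psi>' p)"

definition co_letterplace :: "'p set \<Rightarrow> nat \<Rightarrow> ('p \<Rightarrow> nat) set \<Rightarrow> ('p \<times> nat, 'k::field) mpol set" where
  "co_letterplace P n J = Idl\<^bsub>poly_ring (P \<times> {1..n})\<^esub> {\<Prod>p\<in>P. var (p, \<psi> p) | \<psi>. \<psi> \<in> J}"

text \<open>The identification \<open>var (p, i) \<mapsto> var (i, p)\<close>, as a renaming of exponent vectors.\<close>

definition swap_vars :: "('a \<times> 'b, 'k::field) mpol \<Rightarrow> ('b \<times> 'a, 'k) mpol" where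
  "swap_vars f = Poly_Mapping.map_key (Poly_Mapping.map_key prod.swap) f"

lemma map_key_swap_swap:
  "Poly_Mapping.map_key prod.swap (Poly_Mapping.map_key prod.swap m) = m"
  by (rule poly_mapping_eqI) (simp add: map_key.rep_eq)

lemma lookup_swap_vars:
  fixes f :: "('a \<times> 'b, 'k::field) mpol"
  shows
  "Poly_Mapping.lookup (swap_vars f) m = Poly_Mapping.lookup f (Poly_Mapping.map_key prod.swap m)"
proof -
  have "inj (Poly_Mapping.map_key prod.swap :: ('b \<times> 'a \<Rightarrow>\<^sub>0 nat) \<Rightarrow> ('a \<times> 'b \<Rightarrow>\<^sub>0 nat))"
    by (rule inj_on_inverseI) (rule map_key_swap_swap)
  then show ?thesis
    unfolding swap_vars_def by (subst map_key.rep_eq) simp_all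
qed

lemma swap_vars_monomial_poly:
  "swap_vars (monomial_poly m :: ('a \<times> 'b, 'k::field) mpol)
     = monomial_poly (Poly_Mapping.map_key prod.swap m)"
proof (rule poly_mapping_eqI)
  fix u :: "'b \<times> 'a \<Rightarrow>\<^sub>0 nat"
  have "m = Poly_Mapping.map_key prod.swap u \<longleftrightarrow> Poly_Mapping.map_key prod.swap m = u"
    using map_key_swap_swap by metis
  then show "Poly_Mapping.lookup (swap_vars (monomial_poly m :: ('a \<times> 'b, 'k) mpol)) u
      = Poly_Mapping.lookup (monomial_poly (Poly_Mapping.map_key prod.swap m)) u"
    by (simp add: lookup_swap_vars monomial_poly_def lookup_single)
qed

lemma swap_vars_var: "swap_vars (var (a, b) :: ('a \<times> 'b, 'k::field) mpol) = var (b, a)"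
proof -
  have "Poly_Mapping.map_key prod.swap (Poly_Mapping.single (a, b) (1::nat))
      = Poly_Mapping.single (b, a) 1"
    by (rule poly_mapping_eqI) (auto simp: map_key.rep_eq lookup_single when_def)
  then show ?thesis
    by (simp add: var_def swap_vars_monomial_poly)
qed

definition letterplace :: "nat \<Rightarrow> 'p set \<Rightarrow> ('p \<Rightarrow> nat) set \<Rightarrow> (nat \<times> 'p, 'k::field) mpol set" where
  "letterplace n P J = swap_vars ` alexander_dual (P \<times> {1..n}) (co_letterplace P n J)"

section \<open>Left strict chains and regular sequences\<close>

text \<open>
  \<open>rel_prod leQ leQ'\<close> is the componentwise order of the product of the posets with
  (reflexive) orders \<open>leQ\<close> and \<open>leQ'\<close>.
\<close>

definition left_strict_chain ::
    "('a \<Rightarrow> 'a \<Rightarrow> bool) \<Rightarrow> ('b \<Rightarrow> 'b \<Rightarrow> bool) \<Rightarrow> ('a \<times> 'b) set \<Rightarrow> bool" where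
  "left_strict_chain leQ leQ' C \<longleftrightarrow>
     Complete_Partial_Order.chain (rel_prod leQ leQ') C \<and>
     (\<forall>x\<in>C. \<forall>y\<in>C. rel_prod leQ leQ' x y \<and> x \<noteq> y \<longrightarrow> leQ (fst x) (fst y) \<and> fst x \<noteq> fst y)"

definition isotone_left_strict_chain_fibers ::
    "nat \<Rightarrow> 'p::order set \<Rightarrow> 'r::order set \<Rightarrow> (nat \<times> 'p \<Rightarrow> 'r) \<Rightarrow> bool" where
  "isotone_left_strict_chain_fibers n P R \<phi> \<longleftrightarrow>
     \<phi> \<in> {1..n} \<times> P \<rightarrow> R \<and>
     monotone_on ({1..n} \<times> P) (rel_prod (\<le>) (\<le>)) (\<le>) \<phi> \<and>
     (\<forall>r\<in>R. left_strict_chain (\<le>) (\<ge>) {x \<in> {1..n} \<times> P. \<phi> x = r})"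

definition nonzerodivisor :: "('a, 'm) ring_scheme \<Rightarrow> 'a \<Rightarrow> bool" where
  "nonzerodivisor S a \<longleftrightarrow> a \<in> carrier S \<and>
     (\<forall>y\<in>carrier S. a \<otimes>\<^bsub>S\<^esub> y = \<zero>\<^bsub>S\<^esub> \<longrightarrow> y = \<zero>\<^bsub>S\<^esub>)"

text \<open>The quotient by the whole sequence is not required to be nonzero.\<close>

definition regular_sequence :: "('a, 'm) ring_scheme \<Rightarrow> 'a list \<Rightarrow> bool" where
  "regular_sequence S as \<longleftrightarrow> set as \<subseteq> carrier S \<and>
     (\<forall>i<length as. let I = Idl\<^bsub>S\<^esub> (set (take i as))
        in nonzerodivisor (S Quot I) (I +>\<^bsub>S\<^esub> (as ! i)))"

end

theory Submission
  imports Defs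
begin

text \<open>
  By Alexander duality, \<open>L(n,P;J)\<close> is the intersection of the prime ideals
  \<open>Q\<^sub>\<psi> = (x\<^bsub>\<psi>(p),p\<^esub> : p \<in> P)\<close> for \<open>\<psi> \<in> J\<close> (\<open>letterplace_eq\<close>). Two facts make
  the differences in \<open>B\<close> regular on the quotient by it.

  For a single prime, the quotient by \<open>Q\<^sub>\<psi>\<close> is a polynomial ring, on which linear forms are regular
  as soon as they are linearly independent modulo the variables in \<open>Q\<^sub>\<psi>\<close>
  (\<open>regular_on_differences\<close>). This holds for \<open>B\<close>, which lies in the kernel of \<open>\<phi>\<^sub>1\<close>, because
  \<open>\<phi>\<close> is injective on the graph of \<open>\<psi>\<close>: a left strict chain in \<open>[n] \<times> P\<^sup>o\<^sup>p\<close> meets the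
  graph of an isotone map at most once (\<open>inj_on_graph\<close>). So no nonzero combination of the variables
  in \<open>Q\<^sub>\<psi>\<close> is in that kernel.

  To pass to the intersection, let \<open>\<psi>\<close> be maximal in \<open>J\<close>, let \<open>I\<close> be the ideal for
  \<open>J - {\<psi>}\<close>, and let \<open>v\<close> be the product of the variables \<open>x\<^bsub>i,p\<^esub>\<close> such that \<open>\<psi>\<close> can be
  lowered to the value \<open>i\<close> at \<open>p\<close> alone. Then \<open>v \<in> I\<close> and \<open>I + Q\<^sub>\<psi> = Q\<^sub>\<psi> + (v)\<close>, which is dual to
  the linear quotients of the co-letterplace ideal. Hence, with \<open>S\<close> the
  polynomial ring, there is an exact sequence
  \<open>0 \<rightarrow> S/Q\<^sub>\<psi> \<rightarrow> S/(I \<inter> Q\<^sub>\<psi>) \<rightarrow> S/I \<rightarrow> 0\<close>, and regularity on the two ends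
  implies regularity in the middle (\<open>regular_on_Int\<close>). Induction on \<open>J\<close> finishes the argument
  (\<open>regular_on_meets_graphs\<close>), for the elements of \<open>B\<close> in any order.
\<close>

section \<open>Regular sequences and an exact sequence of quotients\<close>

text \<open>
  The ambient ring \<open>C\<close> is a subring of a commutative ring type, where ring identities are a
  matter of simplification. For the polynomials in the variables of \<open>A\<close>, its ideals are those
  of \<open>poly_ring A\<close>.
\<close>

locale comm_subring =
  fixes C :: "'a::comm_ring_1 set"
  assumes one_mem: "1 \<in> C"
    and diff_mem: "x \<in> C \<Longrightarrow> y \<in> C \<Longrightarrow> x - y \<in> C"
    and mult_mem: "x \<in> C \<Longrightarrow> y \<in> C \<Longrightarrow> x * y \<in> C"
begin

lemma zero_mem: "0 \<in> C"
  using diff_mem[OF one_mem one_mem] by simp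

lemma uminus_mem: "x \<in> C \<Longrightarrow> - x \<in> C"
  using diff_mem[OF zero_mem, of x] by simp

lemma add_mem: "x \<in> C \<Longrightarrow> y \<in> C \<Longrightarrow> x + y \<in> C"
  using diff_mem[of x "- y"] uminus_mem[of y] by simp

definition is_ideal :: "'a set \<Rightarrow> bool" where
  "is_ideal I \<longleftrightarrow> I \<subseteq> C \<and> 0 \<in> I \<and> (\<forall>x\<in>I. \<forall>y\<in>I. x + y \<in> I) \<and> (\<forall>c\<in>C. \<forall>x\<in>I. c * x \<in> I)"

lemma is_idealD:
  assumes "is_ideal I"
  shows "I \<subseteq> C" "0 \<in> I" "x \<in> I \<Longrightarrow> y \<in> I \<Longrightarrow> x + y \<in> I" "c \<in> C \<Longrightarrow> x \<in> I \<Longrightarrow> c * x \<in> I"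
    "x \<in> I \<Longrightarrow> y \<in> I \<Longrightarrow> x - y \<in> I"
proof -
  show *: "I \<subseteq> C" "0 \<in> I" "x \<in> I \<Longrightarrow> y \<in> I \<Longrightarrow> x + y \<in> I" "c \<in> C \<Longrightarrow> x \<in> I \<Longrightarrow> c * x \<in> I" for x y c
    using assms by (auto simp: is_ideal_def)
  show "x \<in> I \<Longrightarrow> y \<in> I \<Longrightarrow> x - y \<in> I"
    using *(3)[of x "(-1) * y"] *(4)[of "-1" y] uminus_mem[OF one_mem] by simp
qed

lemma is_ideal_Int: "is_ideal I \<Longrightarrow> is_ideal Q \<Longrightarrow> is_ideal (I \<inter> Q)"
  by (auto simp: is_ideal_def)

lemma is_ideal_zero: "is_ideal {0}"
  by (auto simp: is_ideal_def zero_mem)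

text \<open>
  For \<open>D = C\<close> this is the ideal \<open>I + (bs)\<close>. Letting the coefficients range over a smaller
  ideal \<open>D\<close> makes products of ideals such as \<open>I \<cdot> (bs)\<close>, which is
  \<open>combinations I {0} bs\<close>, expressible too.
\<close>

primrec combinations :: "'a set \<Rightarrow> 'a set \<Rightarrow> 'a list \<Rightarrow> 'a set" where
  "combinations D I [] = I"
| "combinations D I (b # bs) = {g + c * b | g c. g \<in> combinations D I bs \<and> c \<in> D}"

lemma combinationsI:
  "g \<in> combinations D I bs \<Longrightarrow> c \<in> D \<Longrightarrow> g + c * b \<in> combinations D I (b # bs)"
  by auto

lemma is_ideal_combinations:
  assumes "is_ideal D" "is_ideal I" "set bs \<subseteq> C"
  shows "is_ideal (combinations D I bs)"
  using assms(3)
proof (induction bs)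
  case (Cons b bs)
  let ?K = "combinations D I bs" and ?L = "combinations D I (b # bs)"
  have K: "is_ideal ?K" and b: "b \<in> C"
    using Cons by auto
  note KD = is_idealD[OF K] and DD = is_idealD[OF assms(1)]
  show ?case
    unfolding is_ideal_def
  proof (intro conjI ballI)
    show "?L \<subseteq> C"
      using KD(1) DD(1) b by (auto intro!: add_mem mult_mem)
    show "0 \<in> ?L"
      using combinationsI[OF KD(2) DD(2), of b] by simp
  next
    fix x y assume "x \<in> ?L" "y \<in> ?L"
    then obtain g c g' c' where x: "x = g + c * b" "g \<in> ?K" "c \<in> D"
      and y: "y = g' + c' * b" "g' \<in> ?K" "c' \<in> D"
      by auto
    have "x + y = (g + g') + (c + c') * b"
      by (simp add: x y algebra_simps)
    then show "x + y \<in> ?L"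
      using x y KD(3) DD(3) combinationsI by metis
  next
    fix d x assume d: "d \<in> C" and "x \<in> ?L"
    then obtain g c where x: "x = g + c * b" "g \<in> ?K" "c \<in> D"
      by auto
    have "d * x = d * g + (d * c) * b"
      by (simp add: x algebra_simps)
    then show "d * x \<in> ?L"
      using x d KD(4) DD(4) combinationsI by metis
  qed
qed (simp add: assms)

lemma is_ideal_self: "is_ideal C"
  by (auto simp: is_ideal_def zero_mem add_mem mult_mem)

lemma combinations_base:
  assumes "0 \<in> D" shows "I \<subseteq> combinations D I bs"
proof (induction bs)
  case (Cons b bs)
  then show ?case
    using combinationsI[of _ D I bs 0 b] assms by (auto intro: combinationsI)
qed simp

lemma combinations_generator:
  assumes "is_ideal I" "b \<in> set bs"
  shows "b \<in> combinations C I bs"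
  using assms(2)
proof (induction bs)
  case (Cons a bs)
  have "0 \<in> combinations C I bs"
    using combinations_base[OF zero_mem, of I bs] is_idealD(2)[OF assms(1)] by blast
  then show ?case
    using Cons combinationsI[of 0 C I bs 1 a] combinationsI[of b C I bs 0 a] one_mem zero_mem
    by (cases "b = a") auto
qed simp

lemma combinations_mono:
  assumes "D \<subseteq> D'" "I \<subseteq> I'"
  shows "combinations D I bs \<subseteq> combinations D' I' bs"
  using assms by (induction bs) (simp, force)

lemma combinations_split:
  assumes "is_ideal I" "x \<in> combinations D I bs"
  shows "\<exists>h\<in>I. \<exists>k\<in>combinations D {0} bs. x = h + k"
  using assms(2)
proof (induction bs arbitrary: x)
  case Nil
  then show ?case by auto
next
  case (Cons b bs)
  then obtain g c where x: "x = g + c * b" "g \<in> combinations D I bs" "c \<in> D"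
    by auto
  then obtain h k where g: "h \<in> I" "k \<in> combinations D {0} bs" "g = h + k"
    using Cons.IH by blast
  have "x = h + (k + c * b)"
    by (simp add: x g algebra_simps)
  then show ?case
    using g x combinationsI by metis
qed

lemma combinations_subset:
  assumes "is_ideal N" "I \<subseteq> N" "set bs \<subseteq> N"
  shows "combinations C I bs \<subseteq> N"
  using assms(3) by (induction bs) (use assms is_idealD[OF assms(1)] in auto)

text \<open>
  The head of the list is the last element of the sequence, so that structural recursion on
  lists adds one element at the end of a regular sequence.
\<close>

primrec regular_on :: "'a set \<Rightarrow> 'a list \<Rightarrow> bool" where
  "regular_on I [] \<longleftrightarrow> True"
| "regular_on I (b # bs) \<longleftrightarrow> regular_on I bs \<and>
     (\<forall>f\<in>C. b * f \<in> combinations C I bs \<longrightarrow> f \<in> combinations C I bs)"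

text \<open>
  A relation \<open>c\<^sub>1 b\<^sub>1 + \<dots> + c\<^sub>k b\<^sub>k \<in> I\<close> is trivial when the \<open>b\<^sub>i\<close> are regular
  on \<open>C/I\<close>: regularity puts \<open>c\<^sub>k\<close> into \<open>I + (b\<^sub>1, \<dots>, b\<^bsub>k-1\<^esub>)\<close>, and the part of \<open>c\<^sub>k\<close> in
  \<open>(b\<^sub>1, \<dots>, b\<^bsub>k-1\<^esub>)\<close> can be absorbed into the other coefficients. So
  \<open>I \<inter> (bs) = I (bs)\<close>, which is the vanishing of the first Tor module of \<open>C/I\<close> and
  \<open>C/(bs)\<close>.
\<close>

lemma combinations_Int_regular:
  assumes I: "is_ideal I" and "set bs \<subseteq> C" "regular_on I bs"
    and "f \<in> combinations C {0} bs" "f \<in> I"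
  shows "f \<in> combinations I {0} bs"
  using assms(2-)
proof (induction bs arbitrary: f)
  case (Cons b bs)
  let ?K = "combinations C {0} bs" and ?N = "combinations C I bs"
  have K: "is_ideal ?K" and N: "is_ideal ?N"
    using Cons.prems I is_ideal_self is_ideal_zero by (auto intro: is_ideal_combinations)
  obtain g c where f: "f = g + c * b" "g \<in> ?K" "c \<in> C"
    using Cons.prems by auto
  have "f \<in> ?N"
    using combinations_base[OF zero_mem] Cons.prems by blast
  moreover have "g \<in> ?N"
    using combinations_mono[of C C "{0}" I bs] is_idealD(2)[OF I] f by blast
  ultimately have "b * c \<in> ?N"
    using is_idealD(5)[OF N, of f g] by (simp add: f algebra_simps)
  then have "c \<in> ?N"
    using Cons.prems f by simp
  then obtain h k where c: "h \<in> I" "k \<in> ?K" "c = h + k"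
    using combinations_split[OF I] by blast
  have b: "b \<in> C"
    using Cons.prems by simp
  have "g + b * k \<in> ?K"
    using is_idealD(3,4)[OF K] b c f by blast
  moreover have "g + b * k = f - b * h"
    by (simp add: f c algebra_simps)
  moreover have "f - b * h \<in> I"
    using is_idealD(4,5)[OF I] b c Cons.prems by blast
  ultimately have "g + b * k \<in> combinations I {0} bs"
    using Cons by simp
  then have "(g + b * k) + h * b \<in> combinations I {0} (b # bs)"
    using c combinationsI by blast
  then show ?case
    by (simp add: f c algebra_simps)
qed simp

text \<open>
  Used with \<open>I' = I \<inter> Q\<close> and \<open>D = I\<close>: modulo \<open>I'\<close> every element of \<open>I\<close> is a multiple
  of \<open>v\<close>, hence so is every combination with coefficients in \<open>I\<close>.
\<close>

lemma combinations_coefficients_mod: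
  assumes I': "is_ideal I'" and "set bs \<subseteq> C"
    and D: "\<And>c. c \<in> D \<Longrightarrow> \<exists>q\<in>I'. \<exists>s\<in>C. c = q + s * v"
    and "f \<in> combinations D {0} bs"
  shows "\<exists>h\<in>I'. \<exists>k\<in>combinations C {0} bs. f = h + k * v"
  using assms(2,4)
proof (induction bs arbitrary: f)
  case Nil
  then show ?case
    using is_idealD(2)[OF I'] by auto
next
  case (Cons b bs)
  then obtain g c where f: "f = g + c * b" "g \<in> combinations D {0} bs" "c \<in> D"
    by auto
  obtain h k where g: "h \<in> I'" "k \<in> combinations C {0} bs" "g = h + k * v"
    using Cons.IH[OF _ f(2)] Cons.prems(1) by auto
  obtain q s where c: "q \<in> I'" "s \<in> C" "c = q + s * v"
    using D f by blast
  have "f = (h + b * q) + (k + s * b) * v"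
    by (simp add: f g c algebra_simps)
  moreover have "h + b * q \<in> I'"
    using is_idealD(3,4)[OF I'] Cons.prems g c by simp
  ultimately show ?case
    using g c combinationsI by metis
qed

text \<open>
  If \<open>I + Q = Q + (v)\<close> with \<open>v \<in> I\<close> a nonzerodivisor modulo \<open>Q\<close>, then \<open>I/(I \<inter> Q)\<close> is
  isomorphic to \<open>(I + Q)/Q\<close>, and multiplication by \<open>v\<close> identifies \<open>C/Q\<close> with it. So there is
  an exact sequence \<open>0 \<rightarrow> C/Q \<rightarrow> C/(I \<inter> Q) \<rightarrow> C/I \<rightarrow> 0\<close>. A sequence that is
  regular on both ends is regular on the middle, because dividing by a nonzerodivisor of the
  right end keeps the sequence exact; in terms of elements that exactness is
  \<open>combinations_Int_regular\<close>.
\<close>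

lemma regular_on_Int:
  assumes I: "is_ideal I" and Q: "is_ideal Q" and v: "v \<in> I"
    and IQ: "\<And>f. f \<in> I \<Longrightarrow> \<exists>q\<in>Q. \<exists>s\<in>C. f = q + s * v"
    and cancel: "\<And>f. f \<in> C \<Longrightarrow> f * v \<in> Q \<Longrightarrow> f \<in> Q"
    and "set bs \<subseteq> C" "regular_on I bs" "regular_on Q bs"
  shows "regular_on (I \<inter> Q) bs"
  using assms(6-)
proof (induction bs)
  case (Cons b bs)
  let ?K = "combinations C {0} bs" and ?L = "combinations C (I \<inter> Q) bs"
  have bs: "set bs \<subseteq> C" and b: "b \<in> C"
    using Cons.prems by auto
  have I': "is_ideal (I \<inter> Q)"
    using I Q by (rule is_ideal_Int)
  have K: "is_ideal ?K" and L: "is_ideal ?L" and NQ: "is_ideal (combinations C Q bs)"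
    using bs I' I Q is_ideal_self is_ideal_zero by (auto intro: is_ideal_combinations)
  note KD = is_idealD[OF K] and LD = is_idealD[OF L] and ID = is_idealD[OF I]
    and QD = is_idealD[OF Q]
  have KL: "?K \<subseteq> ?L" and KQ: "?K \<subseteq> combinations C Q bs"
    using combinations_mono[of C C] ID QD by auto
  have I'L: "I \<inter> Q \<subseteq> ?L"
    by (rule combinations_base[OF zero_mem])
  have split: "\<exists>q\<in>I \<inter> Q. \<exists>s\<in>C. f = q + s * v" if fI: "f \<in> I" for f
  proof -
    obtain q s where q: "q \<in> Q" "s \<in> C" "f = q + s * v"
      using IQ[OF fI] by blast
    have "q = f - s * v"
      by (simp add: q)
    then have "q \<in> I"
      using ID(4,5) q v fI by blast
    then show ?thesis
      using q by blast
  qed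
  have "f \<in> ?L" if f: "f \<in> C" and bf: "b * f \<in> ?L" for f
  proof -
    \<comment> \<open>Regularity on the right end reduces \<open>f\<close>, modulo \<open>bs\<close>, to an element of \<open>I\<close>, hence to a multiple of \<open>v\<close>.\<close>
    have "b * f \<in> combinations C I bs"
      using combinations_mono[of C C "I \<inter> Q" I bs] bf by blast
    then have "f \<in> combinations C I bs"
      using Cons.prems f by simp
    then obtain g k where gk: "g \<in> I" "k \<in> ?K" "f = g + k"
      using combinations_split[OF I] by blast
    obtain q s where q: "q \<in> I \<inter> Q" "s \<in> C" "g = q + s * v"
      using split gk by blast
    have "b * q + b * k \<in> ?L"
      using LD(3,4) b q gk KL I'L by (meson subsetD)
    then have "b * f - (b * q + b * k) \<in> ?L"
      using LD(5) bf by blast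
    then have "b * (s * v) \<in> ?L"
      by (simp add: gk q algebra_simps)
    then obtain h c where hc: "h \<in> I \<inter> Q" "c \<in> ?K" "b * (s * v) = h + c"
      using combinations_split[OF I'] by blast
    have "c = b * (s * v) - h"
      by (simp add: hc)
    then have "c \<in> I"
      using ID(4,5) b q v hc mult_mem by (metis IntD1)
    then have "c \<in> combinations I {0} bs"
      using combinations_Int_regular[OF I bs] Cons.prems hc by simp
    then obtain h' t where t: "h' \<in> I \<inter> Q" "t \<in> ?K" "c = h' + t * v"
      using combinations_coefficients_mod[OF I' bs, of I v c] split by blast
    \<comment> \<open>Cancelling \<open>v\<close> modulo \<open>Q\<close> turns the claim into regularity on the left end.\<close>
    have "(b * s - t) * v = h + h'"
      using hc t by (simp add: algebra_simps)
    then have "(b * s - t) * v \<in> Q"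
      using QD(3) hc t by simp
    moreover have "b * s - t \<in> C"
      using b q t KD(1) by (auto intro: diff_mem mult_mem)
    ultimately have "b * s - t \<in> Q"
      using cancel by blast
    then have "(b * s - t) + t \<in> combinations C Q bs"
      using is_idealD(3)[OF NQ] combinations_base[OF zero_mem] KQ t by (meson subsetD)
    then have "s \<in> combinations C Q bs"
      using Cons.prems q by simp
    then obtain q' k' where s: "q' \<in> Q" "k' \<in> ?K" "s = q' + k'"
      using combinations_split[OF Q] by blast
    have vC: "v \<in> C"
      using v ID(1) by blast
    have "v * q' \<in> I \<inter> Q"
      using ID(4)[of q' v] QD(1) QD(4)[of v q'] s v vC by (simp add: mult.commute subset_iff)
    then have "v * q' + v * k' \<in> ?L"
      using LD(3) I'L KD(4)[OF vC] KL s by blast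
    then have "q + (v * q' + v * k') + k \<in> ?L"
      using LD(3) I'L KL q gk by (meson subsetD)
    then show ?thesis
      by (simp add: gk q s algebra_simps)
  qed
  moreover have "regular_on (I \<inter> Q) bs"
    using Cons by simp
  ultimately show ?case
    by simp
qed simp

lemma regular_on_self: "set bs \<subseteq> C \<Longrightarrow> regular_on C bs"
proof (induction bs)
  case (Cons b bs)
  then show ?case
    using combinations_base[OF zero_mem, of C bs] by auto
qed simp

end

section \<open>Regular sequences in a quotient ring\<close>

lemma zero_Quot: "\<zero>\<^bsub>R Quot I\<^esub> = I"
  by (simp add: FactRing_def)

lemma (in cring) coset_mem_genideal_Quot:
  assumes I: "ideal I R" and T: "T \<subseteq> carrier R" and f: "f \<in> carrier R"
  shows "I +> f \<in> Idl\<^bsub>R Quot I\<^esub> ((+>) I ` T) \<longleftrightarrow> f \<in> Idl (I \<union> T)"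
proof -
  let ?S = "R Quot I" and ?h = "(+>) I"
  interpret I: ideal I R by fact
  interpret h: ring_hom_ring R ?S ?h by (rule I.rcos_ring_hom_ring)
  have hT: "?h ` T \<subseteq> carrier ?S"
    using T h.hom_closed by blast
  have IT: "I \<union> T \<subseteq> carrier R"
    using T I.a_subset by blast
  show ?thesis
  proof
    assume L: "?h f \<in> Idl\<^bsub>?S\<^esub> (?h ` T)"
    have K: "ideal (Idl (I \<union> T)) R"
      by (rule genideal_ideal[OF IT])
    have "ideal (?h ` (Idl (I \<union> T))) ?S"
      by (rule ring_ideal_imp_quot_ideal[OF I K])
    moreover have "?h ` T \<subseteq> ?h ` (Idl (I \<union> T))"
      using genideal_self[OF IT] by blast
    ultimately have "?h f \<in> ?h ` (Idl (I \<union> T))"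
      using L h.S.genideal_minimal by blast
    then obtain g where g: "g \<in> Idl (I \<union> T)" "?h f = ?h g"
      by blast
    have gR: "g \<in> carrier R"
      using g(1) ideal.Icarr[OF K] by blast
    have "f \<ominus> g \<in> I"
      using quotient_eq_iff_same_a_r_cos[OF I f gR] g by simp
    then have d: "f \<ominus> g \<in> Idl (I \<union> T)"
      using genideal_self[OF IT] by blast
    have "(f \<ominus> g) \<oplus> g \<in> Idl (I \<union> T)"
      using ideal.axioms(1)[OF K] additive_subgroup.a_closed[OF _ d g(1)] by blast
    then show "f \<in> Idl (I \<union> T)"
      using f gR by (simp add: minus_eq a_assoc l_neg)
  next
    let ?V = "{r \<in> carrier R. ?h r \<in> Idl\<^bsub>?S\<^esub> (?h ` T)}"
    have ids: "ideal (Idl\<^bsub>?S\<^esub> (?h ` T)) ?S"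
      by (rule h.S.genideal_ideal[OF hT])
    have V: "ideal ?V R"
      by (rule h.ideal_vimage[OF ids])
    have "I \<subseteq> ?V"
    proof
      fix x assume x: "x \<in> I"
      then have "?h x = \<zero>\<^bsub>?S\<^esub>"
        using a_rcos_zero[OF I] by (simp add: zero_Quot)
      then have "?h x \<in> Idl\<^bsub>?S\<^esub> (?h ` T)"
        using additive_subgroup.zero_closed[OF ideal.axioms(1)[OF ids]] by metis
      then show "x \<in> ?V"
        using I.Icarr[OF x] by blast
    qed
    moreover have "T \<subseteq> ?V"
      using T h.S.genideal_self[OF hT] by blast
    ultimately have "Idl (I \<union> T) \<subseteq> ?V"
      by (intro genideal_minimal[OF V] Un_least)
    then show "?h f \<in> Idl\<^bsub>?S\<^esub> (?h ` T)" if "f \<in> Idl (I \<union> T)"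
      using that by blast
  qed
qed

text \<open>
  The nested quotient \<open>(R/I)/(b\<^sub>1, \<dots>, b\<^sub>i)\<close> is traded for congruences in \<open>R\<close>
  itself, where no cosets have to be handled.
\<close>

lemma (in cring) regular_sequence_Quot:
  assumes I: "ideal I R" and bs: "set bs \<subseteq> carrier R"
    and reg: "\<And>i f. i < length bs \<Longrightarrow> f \<in> carrier R \<Longrightarrow>
      bs ! i \<otimes> f \<in> Idl (I \<union> set (take i bs)) \<Longrightarrow> f \<in> Idl (I \<union> set (take i bs))"
  shows "regular_sequence (R Quot I) (map (\<lambda>b. I +> b) bs)"
proof -
  let ?S = "R Quot I" and ?h = "(+>) I"
  interpret I: ideal I R by fact
  interpret h: ring_hom_ring R ?S ?h by (rule I.rcos_ring_hom_ring)
  have carr: "set (map ?h bs) \<subseteq> carrier ?S"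
    using bs h.hom_closed by auto
  have "nonzerodivisor (?S Quot Idl\<^bsub>?S\<^esub> (set (take i (map ?h bs))))
      (Idl\<^bsub>?S\<^esub> (set (take i (map ?h bs))) +>\<^bsub>?S\<^esub> (map ?h bs ! i))" if i: "i < length bs" for i
  proof -
    let ?T = "set (take i bs)"
    let ?K = "Idl\<^bsub>?S\<^esub> (?h ` ?T)"
    have T: "?T \<subseteq> carrier R"
      using bs set_take_subset by fast
    have K: "ideal ?K ?S"
      by (rule h.S.genideal_ideal) (use T h.hom_closed in blast)
    interpret K: ideal ?K ?S by (rule K)
    interpret k: ring_hom_ring ?S "?S Quot ?K" "(+>\<^bsub>?S\<^esub>) ?K" by (rule K.rcos_ring_hom_ring)
    have zero: "?K +>\<^bsub>?S\<^esub> y = \<zero>\<^bsub>?S Quot ?K\<^esub> \<longleftrightarrow> y \<in> ?K" if "y \<in> carrier ?S" for y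
      unfolding zero_Quot using h.S.a_rcos_zero[OF K] K.rcos_const_imp_mem that by metis
    have b: "bs ! i \<in> carrier R"
      using bs i by force
    have "nonzerodivisor (?S Quot ?K) (?K +>\<^bsub>?S\<^esub> ?h (bs ! i))"
      unfolding nonzerodivisor_def
    proof (intro conjI ballI impI)
      show "?K +>\<^bsub>?S\<^esub> ?h (bs ! i) \<in> carrier (?S Quot ?K)"
        using b by simp
      fix y assume "y \<in> carrier (?S Quot ?K)"
      then obtain z where z: "z \<in> carrier ?S" "y = ?K +>\<^bsub>?S\<^esub> z"
        unfolding FactRing_simps(1) A_RCOSETS_def RCOSETS_def a_r_coset_def by auto
      then obtain f where f: "f \<in> carrier R" "z = ?h f"
        unfolding FactRing_simps(1) A_RCOSETS_def RCOSETS_def a_r_coset_def by auto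
      assume "(?K +>\<^bsub>?S\<^esub> ?h (bs ! i)) \<otimes>\<^bsub>?S Quot ?K\<^esub> y = \<zero>\<^bsub>?S Quot ?K\<^esub>"
      then have "?K +>\<^bsub>?S\<^esub> ?h (bs ! i \<otimes> f) = \<zero>\<^bsub>?S Quot ?K\<^esub>"
        using b f z by (metis h.hom_closed h.hom_mult k.hom_mult)
      then have "?h (bs ! i \<otimes> f) \<in> ?K"
        using zero[OF h.hom_closed[OF m_closed[OF b f(1)]]] by simp
      then have "f \<in> Idl (I \<union> ?T)"
        by (intro reg[OF i f(1)] iffD1[OF coset_mem_genideal_Quot[OF I T m_closed[OF b f(1)]]])
      then have "z \<in> ?K"
        unfolding f(2) by (rule iffD2[OF coset_mem_genideal_Quot[OF I T f(1)]])
      then show "y = \<zero>\<^bsub>?S Quot ?K\<^esub>"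
        using zero[OF z(1)] z(2) by simp
    qed
    then show ?thesis
      using i by (simp add: take_map)
  qed
  then show ?thesis
    unfolding regular_sequence_def Let_def using carr by simp
qed

section \<open>Substitution\<close>

definition polys :: "'v set \<Rightarrow> ('v, 'k::field) mpol set" where
  "polys A = {f. Poly_Mapping.keys f \<subseteq> monomials_in A}"

lemma comm_subring_polys: "comm_subring (polys A :: ('v, 'k::field) mpol set)"
proof
  show "(1::('v, 'k) mpol) \<in> polys A"
    by (simp add: polys_def monomials_in_def)
next
  fix f g :: "('v, 'k) mpol"
  assume "f \<in> polys A" "g \<in> polys A"
  then show "f - g \<in> polys A" "f * g \<in> polys A"
    using Poly_Mapping.keys_diff[of f g] poly_ring_mult_closed[of f A g]
    by (auto simp: polys_def)
qed

lemma monomial_poly_0: "monomial_poly 0 = 1"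
  by (simp add: monomial_poly_def)

lemma monomial_poly_add: "monomial_poly (m + m') = monomial_poly m * monomial_poly m'"
  by (simp add: monomial_poly_def mult_single)

lemma monomial_poly_sum: "monomial_poly (sum g S) = (\<Prod>x\<in>S. monomial_poly (g x))"
  by (induction S rule: infinite_finite_induct) (simp_all add: monomial_poly_0 monomial_poly_add)

lemma keys_monomial_poly [simp]:
  "Poly_Mapping.keys (monomial_poly m :: ('v, 'k::field) mpol) = {m}"
  by (simp add: monomial_poly_def)

lemma scale_eq_mult: "scale c f = Poly_Mapping.single 0 c * f"
  by (simp add: scale_def mult_map_scale_conv_mult)

lemma scale_mult_scale: "scale c f * scale d g = scale (c * d) (f * g)"
proof -
  have *: "Poly_Mapping.single 0 (c * d) = Poly_Mapping.single 0 c * Poly_Mapping.single 0 d"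
    by (simp add: mult_single)
  then show ?thesis
    unfolding scale_eq_mult * by (simp only: ac_simps)
qed

lemma var_mem_polys: "a \<in> A \<Longrightarrow> var a \<in> polys A"
  by (simp add: polys_def var_def monomials_in_def)

lemma single_mem_polys: "m \<in> monomials_in A \<Longrightarrow> Poly_Mapping.single m c \<in> polys A"
  by (simp add: polys_def)

lemma const_mem_polys: "Poly_Mapping.single 0 c \<in> polys A"
  by (simp add: polys_def monomials_in_def)

lemma lookup_monomial_poly_mult:
  "Poly_Mapping.lookup (monomial_poly u * f) (u + m) = Poly_Mapping.lookup f m"
proof -
  have "Poly_Mapping.lookup (monomial_poly u * f) (u + m)
      = (\<Sum>l. (\<Sum>q. Poly_Mapping.lookup f q when u + m = l + q) when u = l)"
    by (simp add: lookup_mult monomial_poly_def lookup_single when_mult)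
  also have "\<dots> = (\<Sum>q. Poly_Mapping.lookup f q when m = q)"
    by simp
  finally show ?thesis by simp
qed

lemma monomial_decomp_var:
  assumes "a \<in> Poly_Mapping.keys (m :: 'v \<Rightarrow>\<^sub>0 nat)"
  shows "\<exists>m'. m = Poly_Mapping.single a 1 + m' \<and>
    (\<forall>b. Poly_Mapping.lookup m' b = (if b = a then Poly_Mapping.lookup m b - 1 else Poly_Mapping.lookup m b))"
proof (intro exI conjI)
  let ?m' = "m - Poly_Mapping.single a 1"
  have "Poly_Mapping.lookup m a \<noteq> 0"
    using assms by (simp add: in_keys_iff)
  then show "m = Poly_Mapping.single a 1 + ?m'"
    by (intro poly_mapping_eqI) (auto simp: lookup_add lookup_minus lookup_single when_def)
  show "\<forall>b. Poly_Mapping.lookup ?m' b = (if b = a then Poly_Mapping.lookup m b - 1 else Poly_Mapping.lookup m b)"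
    by (auto simp: lookup_minus lookup_single when_def)
qed

lemma var_mult_eq_0: 
  assumes "var a * f = 0" shows "f = 0"
proof (rule poly_mapping_eqI)
  fix m show "Poly_Mapping.lookup f m = Poly_Mapping.lookup 0 m"
    using lookup_monomial_poly_mult[of "Poly_Mapping.single a 1" f m] assms by (simp add: var_def)
qed

text \<open>
  The usual comparison of leading terms would need a monomial order. Instead the
  exponent of \<open>b\<close> serves as the measure: if \<open>var a * f = var b * f\<close>,
  the coefficient of \<open>f\<close> at \<open>m\<close> equals the one at \<open>m a / b\<close>, and is \<open>0\<close> when \<open>b\<close> does not
  divide \<open>m\<close>.
\<close>

lemma var_diff_mult_eq_0:
  assumes "a \<noteq> b" "(var a - var b) * f = 0"
  shows "f = 0"
proof -
  have eq: "var a * f = var b * f"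
    using assms by (simp add: algebra_simps)
  have "Poly_Mapping.lookup f m = 0" for m
  proof (induction "Poly_Mapping.lookup m b" arbitrary: m)
    case (0 m)
    let ?m = "Poly_Mapping.single a 1 + m"
    have "?m \<notin> Poly_Mapping.keys (var b * f)"
    proof
      assume "?m \<in> Poly_Mapping.keys (var b * f)"
      then obtain m' where "?m = Poly_Mapping.single b 1 + m'"
        using Poly_Mapping.keys_mult[of "var b" f] by (auto simp: var_def monomial_poly_def split: if_splits)
      then have "Poly_Mapping.lookup ?m b = Poly_Mapping.lookup (Poly_Mapping.single b 1 + m') b"
        by simp
      then show False
        using 0 assms(1) by (simp add: lookup_add lookup_single when_def)
    qed
    then show ?case
      using lookup_monomial_poly_mult[of "Poly_Mapping.single a 1" f m] eq
      by (simp add: var_def in_keys_iff)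
  next
    case (Suc j m)
    have "b \<in> Poly_Mapping.keys m"
      using Suc(2) by (simp add: in_keys_iff)
    from monomial_decomp_var[OF this] obtain m' where m': "m = Poly_Mapping.single b 1 + m'"
      "Poly_Mapping.lookup m' b = Poly_Mapping.lookup m b - 1"
      by auto
    let ?m = "Poly_Mapping.single a 1 + m'"
    have "Poly_Mapping.lookup ?m b = j"
      using Suc(2) m'(2) assms(1) by (simp add: lookup_add lookup_single when_def)
    then have "Poly_Mapping.lookup f ?m = 0"
      using Suc(1) by simp
    then have "Poly_Mapping.lookup (var a * f) (Poly_Mapping.single b 1 + ?m) = 0"
      using lookup_monomial_poly_mult[of "Poly_Mapping.single b 1" f ?m] eq by (simp add: var_def)
    then show ?case
      using lookup_monomial_poly_mult[of "Poly_Mapping.single a 1" f m]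
      by (simp add: var_def m'(1) ac_simps)
  qed
  then show ?thesis
    by (intro poly_mapping_eqI) simp
qed

lemma poly_mapping_single_induct [case_names zero single_add]:
  assumes "Q 0" "\<And>m c f. m \<notin> Poly_Mapping.keys f \<Longrightarrow> c \<noteq> 0 \<Longrightarrow> Q f \<Longrightarrow> Q (Poly_Mapping.single m c + f)"
  shows "Q f"
proof (induction f rule: update_induct)
  case (update f a b)
  have "Poly_Mapping.update a b f = Poly_Mapping.single a b + f"
    using update(1)
    by (intro poly_mapping_eqI)
      (auto simp: lookup_update lookup_add lookup_single when_def in_keys_iff)
  then show ?case
    using assms(2) update by metis
qed (rule assms(1))

lemma keys_single_add:
  assumes "m \<notin> Poly_Mapping.keys f" "c \<noteq> 0"
  shows "Poly_Mapping.keys (Poly_Mapping.single m c + f) = insert m (Poly_Mapping.keys f)"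
  using assms by (auto simp: in_keys_iff lookup_add lookup_single when_def split: if_splits)

definition subst_monomial :: "('v \<Rightarrow> 'b::comm_semiring_1) \<Rightarrow> ('v \<Rightarrow>\<^sub>0 nat) \<Rightarrow> 'b" where
  "subst_monomial \<sigma> m = (\<Prod>a\<in>Poly_Mapping.keys m. \<sigma> a ^ Poly_Mapping.lookup m a)"

text \<open>
  The ring homomorphism that sends each variable \<open>a\<close> to \<open>\<sigma> a\<close> and fixes the constants.
\<close>

definition subst :: "('v \<Rightarrow> ('w, 'k::field) mpol) \<Rightarrow> ('v, 'k) mpol \<Rightarrow> ('w, 'k) mpol" where
  "subst \<sigma> f = (\<Sum>m\<in>Poly_Mapping.keys f. scale (Poly_Mapping.lookup f m) (subst_monomial \<sigma> m))"

lemma subst_monomial_superset: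
  assumes "finite S" "Poly_Mapping.keys m \<subseteq> S"
  shows "subst_monomial \<sigma> m = (\<Prod>a\<in>S. \<sigma> a ^ Poly_Mapping.lookup m a)"
  unfolding subst_monomial_def
  by (rule prod.mono_neutral_left) (use assms in \<open>auto simp: in_keys_iff\<close>)

lemma subst_monomial_add: "subst_monomial \<sigma> (m + m') = subst_monomial \<sigma> m * subst_monomial \<sigma> m'"
proof -
  let ?S = "Poly_Mapping.keys m \<union> Poly_Mapping.keys m'"
  have "finite ?S" "Poly_Mapping.keys (m + m') \<subseteq> ?S"
    using Poly_Mapping.keys_add[of m m'] by auto
  then show ?thesis
    by (simp add: subst_monomial_superset[of ?S] lookup_add power_add prod.distrib)
qed

lemma subst_superset:
  assumes "finite S" "Poly_Mapping.keys f \<subseteq> S"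
  shows "subst \<sigma> f = (\<Sum>m\<in>S. scale (Poly_Mapping.lookup f m) (subst_monomial \<sigma> m))"
  unfolding subst_def
  by (rule sum.mono_neutral_left) (use assms in \<open>auto simp: in_keys_iff\<close>)

lemma subst_zero [simp]: "subst \<sigma> 0 = 0"
  by (simp add: subst_def)

lemma subst_add: "subst \<sigma> (f + g) = subst \<sigma> f + subst \<sigma> g"
proof -
  let ?S = "Poly_Mapping.keys f \<union> Poly_Mapping.keys g"
  have "finite ?S" "Poly_Mapping.keys (f + g) \<subseteq> ?S"
    using Poly_Mapping.keys_add[of f g] by auto
  then show ?thesis
    by (simp add: subst_superset[of ?S] lookup_add pol.scale_left_distrib sum.distrib)
qed

lemma subst_single: "subst \<sigma> (Poly_Mapping.single m c) = scale c (subst_monomial \<sigma> m)"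
  by (simp add: subst_def)

lemma subst_scale: "subst \<sigma> (scale c f) = scale c (subst \<sigma> f)"
proof -
  have "Poly_Mapping.keys (scale c f) \<subseteq> Poly_Mapping.keys f"
    by (auto simp: in_keys_iff lookup_scale)
  then show ?thesis
    by (simp add: subst_superset[of "Poly_Mapping.keys f"] lookup_scale pol.scale_sum_right)
qed

lemma subst_diff: "subst \<sigma> (f - g) = subst \<sigma> f - subst \<sigma> g"
  using subst_add[of \<sigma> "f - g" g] by simp

lemma subst_mult: "subst \<sigma> (f * g) = subst \<sigma> f * subst \<sigma> g"
proof (induction f rule: poly_mapping_single_induct)
  case (single_add m c f)
  have "subst \<sigma> (Poly_Mapping.single m c * g) = subst \<sigma> (Poly_Mapping.single m c) * subst \<sigma> g"
  proof (induction g rule: poly_mapping_single_induct)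
    case (single_add m' c' g)
    have "subst \<sigma> (Poly_Mapping.single m c * Poly_Mapping.single m' c')
        = subst \<sigma> (Poly_Mapping.single m c) * subst \<sigma> (Poly_Mapping.single m' c')"
      by (simp add: mult_single subst_single subst_monomial_add scale_mult_scale)
    then show ?case
      using single_add by (simp add: distrib_left subst_add)
  qed simp
  then show ?case
    using single_add by (simp add: distrib_right subst_add)
qed simp

lemma subst_var: "subst \<sigma> (var a) = \<sigma> a"
  by (simp add: var_def monomial_poly_def subst_single subst_monomial_def)

text \<open>
  A substitution that moves each variable only within its class modulo the ideal \<open>N\<close> does the
  same with every polynomial; so if it also kills \<open>N\<close>, its kernel is \<open>N\<close>.
\<close>

lemma subst_congruent:
  fixes N :: "('v, 'k::field) mpol set"
  assumes N: "comm_subring.is_ideal (polys A) N"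
    and \<sigma>: "\<And>a. a \<in> A \<Longrightarrow> \<sigma> a \<in> polys A \<and> var a - \<sigma> a \<in> N" and f: "f \<in> polys A"
  shows "subst \<sigma> f \<in> polys A \<and> f - subst \<sigma> f \<in> N"
  using f
proof (induction f rule: poly_mapping_single_induct)
  interpret comm_subring "polys A :: ('v, 'k) mpol set" by (rule comm_subring_polys)
  note ND = is_idealD[OF N]
  {
    case zero
    then show ?case
      using ND(2) by simp
  next
    case (single_add m c f)
    have m: "m \<in> monomials_in A" and f: "f \<in> polys A"
      using single_add(4) by (simp_all add: polys_def keys_single_add[OF single_add(1,2)])
    have "subst_monomial \<sigma> m \<in> polys A \<and> monomial_poly m - subst_monomial \<sigma> m \<in> N"
      using m
    proof (induction "\<Sum>a\<in>Poly_Mapping.keys m. Poly_Mapping.lookup m a" arbitrary: m)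
      case (0 m)
      then have "m = 0"
        by (auto intro!: poly_mapping_eqI simp: in_keys_iff)
      then show ?case
        using one_mem ND(2) by (simp add: subst_monomial_def monomial_poly_0)
    next
      case (Suc j m)
      then obtain a where a: "a \<in> Poly_Mapping.keys m"
        by fastforce
      from monomial_decomp_var[OF this] obtain m' where m': "m = Poly_Mapping.single a 1 + m'" and
        l: "\<And>b. Poly_Mapping.lookup m' b
          = (if b = a then Poly_Mapping.lookup m b - 1 else Poly_Mapping.lookup m b)"
        by blast
      have k: "Poly_Mapping.keys m' \<subseteq> Poly_Mapping.keys m"
        by (auto simp: in_keys_iff l split: if_splits)
      have "(\<Sum>b\<in>Poly_Mapping.keys m. Poly_Mapping.lookup m b)
          = (\<Sum>b\<in>Poly_Mapping.keys m. (if b = a then 1 else 0) + Poly_Mapping.lookup m' b)"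
        by (rule sum.cong) (auto simp: l in_keys_iff)
      also have "\<dots> = 1 + (\<Sum>b\<in>Poly_Mapping.keys m. Poly_Mapping.lookup m' b)"
        using a by (simp add: sum.distrib)
      also have "(\<Sum>b\<in>Poly_Mapping.keys m. Poly_Mapping.lookup m' b)
          = (\<Sum>b\<in>Poly_Mapping.keys m'. Poly_Mapping.lookup m' b)"
        by (rule sum.mono_neutral_right) (use k in \<open>auto simp: in_keys_iff\<close>)
      finally have "j = (\<Sum>b\<in>Poly_Mapping.keys m'. Poly_Mapping.lookup m' b)"
        using Suc(2) by simp
      moreover have "m' \<in> monomials_in A" and aA: "a \<in> A"
        using Suc(3) k a by (auto simp: monomials_in_def)
      ultimately have IH: "subst_monomial \<sigma> m' \<in> polys A" "monomial_poly m' - subst_monomial \<sigma> m' \<in> N"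
        using Suc(1) by auto
      have s: "subst_monomial \<sigma> m = \<sigma> a * subst_monomial \<sigma> m'"
        by (simp add: m' subst_monomial_add) (simp add: subst_monomial_def)
      have "monomial_poly m - subst_monomial \<sigma> m
          = var a * (monomial_poly m' - subst_monomial \<sigma> m') + subst_monomial \<sigma> m' * (var a - \<sigma> a)"
        unfolding s unfolding m' monomial_poly_add by (simp add: var_def algebra_simps)
      also have "\<dots> \<in> N"
        using ND(3,4) IH \<sigma>[OF aA] var_mem_polys[OF aA] by blast
      finally show ?case
        using s mult_mem \<sigma>[OF aA] IH by metis
    qed
    note sm = this
    have const: "Poly_Mapping.single 0 c \<in> polys A"
      by (rule const_mem_polys)
    have sc: "Poly_Mapping.single m c = scale c (monomial_poly m)"
      by (simp add: scale_eq_mult monomial_poly_def mult_single)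
    have "Poly_Mapping.single m c + f - subst \<sigma> (Poly_Mapping.single m c + f)
        = Poly_Mapping.single 0 c * (monomial_poly m - subst_monomial \<sigma> m) + (f - subst \<sigma> f)"
      unfolding subst_add subst_single unfolding sc scale_eq_mult by (simp add: algebra_simps)
    moreover have "subst \<sigma> (Poly_Mapping.single m c + f)
        = Poly_Mapping.single 0 c * subst_monomial \<sigma> m + subst \<sigma> f"
      by (simp add: subst_add subst_single scale_eq_mult)
    ultimately show ?case
      using ND(3,4) sm single_add(3)[OF f] const add_mem mult_mem by metis
  }
qed

section \<open>Monomial ideals\<close>

definition monomial_ideal :: "'v set \<Rightarrow> (('v \<Rightarrow>\<^sub>0 nat) \<Rightarrow> bool) \<Rightarrow> ('v, 'k::field) mpol set" where
  "monomial_ideal A M = {f. \<forall>m\<in>Poly_Mapping.keys f. m \<in> monomials_in A \<and> M m}"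

definition up_closed :: "(('v \<Rightarrow>\<^sub>0 nat) \<Rightarrow> bool) \<Rightarrow> bool" where
  "up_closed M \<longleftrightarrow> (\<forall>m u. M m \<longrightarrow> M (u + m))"

lemma is_ideal_monomial_ideal:
  assumes "up_closed M"
  shows "comm_subring.is_ideal (polys A) (monomial_ideal A M :: ('v, 'k::field) mpol set)"
proof -
  interpret comm_subring "polys A :: ('v, 'k) mpol set" by (rule comm_subring_polys)
  show ?thesis
    unfolding is_ideal_def
  proof (intro conjI ballI)
    fix f g :: "('v, 'k) mpol"
    assume "f \<in> monomial_ideal A M" "g \<in> monomial_ideal A M"
    then show "f + g \<in> monomial_ideal A M"
      using Poly_Mapping.keys_add[of f g] by (auto simp: monomial_ideal_def)
  next
    fix c f :: "('v, 'k) mpol"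
    assume c: "c \<in> polys A" and f: "f \<in> monomial_ideal A M"
    show "c * f \<in> monomial_ideal A M"
      unfolding monomial_ideal_def
    proof (intro CollectI ballI)
      fix m assume "m \<in> Poly_Mapping.keys (c * f)"
      then obtain u v where "m = u + v" "u \<in> Poly_Mapping.keys c" "v \<in> Poly_Mapping.keys f"
        using Poly_Mapping.keys_mult[of c f] by blast
      then show "m \<in> monomials_in A \<and> M m"
        using c f assms monomials_in_add[of u A v] by (auto simp: monomial_ideal_def up_closed_def polys_def)
    qed
  qed (auto simp: monomial_ideal_def polys_def)
qed

lemma monomial_ideal_Int:
  "monomial_ideal A M \<inter> monomial_ideal A N = monomial_ideal A (\<lambda>m. M m \<and> N m)"
  by (auto simp: monomial_ideal_def)

lemma keys_add_nat: "Poly_Mapping.keys (m + m' :: 'v \<Rightarrow>\<^sub>0 nat) = Poly_Mapping.keys m \<union> Poly_Mapping.keys m'"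
  by (auto simp: in_keys_iff lookup_add)

section \<open>Differences of variables modulo variables\<close>

lemma span_subset_ideal:
  fixes N :: "('v, 'k::field) mpol set"
  assumes N: "comm_subring.is_ideal (polys A) N" and "S \<subseteq> N"
  shows "pol.span S \<subseteq> N"
proof -
  interpret comm_subring "polys A :: ('v, 'k) mpol set" by (rule comm_subring_polys)
  have "pol.subspace N"
    unfolding pol.subspace_def scale_eq_mult
    by (intro conjI ballI allI is_idealD(2-4)[OF N] const_mem_polys)
  then show ?thesis
    using assms(2) by (rule pol.span_minimal[rotated])
qed

lemma subst_span:
  assumes "\<And>a. a \<in> A \<Longrightarrow> var a - \<sigma> a \<in> pol.span S" "f \<in> pol.span (var ` A)"
  shows "f - subst \<sigma> f \<in> pol.span S"
  using assms(2)
proof (induction rule: pol.span_induct_alt)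
  case base
  then show ?case by (simp add: pol.span_zero)
next
  case (step c x y)
  then obtain a where a: "a \<in> A" "x = var a" by auto
  have "scale c x + y - subst \<sigma> (scale c x + y) = scale c (var a - \<sigma> a) + (y - subst \<sigma> y)"
    by (simp add: a subst_add subst_scale subst_var pol.scale_right_diff_distrib)
  then show ?case
    using step assms(1)[OF a(1)] by (metis pol.span_add pol.span_scale)
qed

text \<open>
  Setting the variables in \<open>U\<close> to zero and identifying the variables joined by the differences in
  \<open>S\<close> is realised inside the same polynomial ring: \<open>\<sigma>\<close> sends each variable to a chosen
  representative of its class, or to \<open>0\<close> if the class meets \<open>U\<close>. Representatives are tied to
  their class by a span rather than an ideal, because linear independence is a hypothesis on spans.
\<close>

definition collapsing :: "'v set \<Rightarrow> 'v set \<Rightarrow> ('v, 'k::field) mpol set \<Rightarrow> ('v \<Rightarrow> ('v, 'k) mpol) \<Rightarrow> bool" where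
  "collapsing A U S \<sigma> \<longleftrightarrow> (\<forall>a\<in>A. \<sigma> a \<in> insert 0 (var ` A) \<and> var a - \<sigma> a \<in> pol.span (var ` U \<union> S)) \<and>
     (\<forall>a\<in>U. \<sigma> a = 0) \<and> (\<forall>f\<in>S. subst \<sigma> f = 0)"

text \<open>
  So the quotient by \<open>U\<close> and \<open>bs\<close> is again a polynomial ring, namely the image of the
  substitution.
\<close>

lemma combinations_eq_kernel:
  fixes \<sigma> :: "'v \<Rightarrow> ('v, 'k::field) mpol"
  assumes \<sigma>: "collapsing A U (set bs) \<sigma>" and U: "U \<subseteq> A" and bs: "set bs \<subseteq> polys A"
  shows "comm_subring.combinations (polys A) (monomial_ideal A (\<lambda>m. Poly_Mapping.keys m \<inter> U \<noteq> {})) bs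
    = {f \<in> polys A. subst \<sigma> f = 0}"
proof -
  interpret comm_subring "polys A :: ('v, 'k) mpol set" by (rule comm_subring_polys)
  let ?Q = "monomial_ideal A (\<lambda>m. Poly_Mapping.keys m \<inter> U \<noteq> {}) :: ('v, 'k) mpol set"
  let ?N = "combinations (polys A) ?Q bs"
  have Q: "is_ideal ?Q"
    by (rule is_ideal_monomial_ideal) (auto simp: up_closed_def keys_add_nat)
  have N: "is_ideal ?N"
    using is_ideal_combinations[OF is_ideal_self Q bs] .
  have varQ: "var ` U \<subseteq> ?Q"
    using U by (auto simp: monomial_ideal_def var_def monomials_in_def)
  have QN: "?Q \<subseteq> ?N"
    by (rule combinations_base[OF zero_mem])
  have span: "pol.span (var ` U \<union> set bs) \<subseteq> ?N"
    using combinations_generator[OF Q] varQ QN by (intro span_subset_ideal[OF N]) blast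
  have \<sigma>A: "\<sigma> a \<in> polys A \<and> var a - \<sigma> a \<in> ?N" if "a \<in> A" for a
  proof -
    have "\<sigma> a \<in> insert 0 (var ` A)" "var a - \<sigma> a \<in> pol.span (var ` U \<union> set bs)"
      using \<sigma> that by (simp_all add: collapsing_def)
    then show ?thesis
      using span zero_mem var_mem_polys by auto
  qed
  have Z: "is_ideal {f \<in> polys A. subst \<sigma> f = 0}"
    unfolding is_ideal_def using zero_mem add_mem mult_mem by (auto simp: subst_add subst_mult)
  have "?Q \<subseteq> {f \<in> polys A. subst \<sigma> f = 0}"
  proof
    fix f :: "('v, 'k) mpol" assume f: "f \<in> ?Q"
    have "subst_monomial \<sigma> m = 0" if "m \<in> Poly_Mapping.keys f" for m
    proof -
      obtain a where a: "a \<in> Poly_Mapping.keys m" "a \<in> U"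
        using f \<open>m \<in> _\<close> by (auto simp: monomial_ideal_def)
      then have "\<sigma> a ^ Poly_Mapping.lookup m a = 0"
        using \<sigma> by (simp add: collapsing_def in_keys_iff power_0_left)
      then show ?thesis
        unfolding subst_monomial_def using a(1) by (intro prod_zero) auto
    qed
    then show "f \<in> {f \<in> polys A. subst \<sigma> f = 0}"
      using f by (auto simp: subst_def monomial_ideal_def polys_def)
  qed
  moreover have "set bs \<subseteq> {f \<in> polys A. subst \<sigma> f = 0}"
    using \<sigma> bs by (auto simp: collapsing_def)
  ultimately have "?N \<subseteq> {f \<in> polys A. subst \<sigma> f = 0}"
    by (rule combinations_subset[OF Z])
  moreover have "{f \<in> polys A. subst \<sigma> f = 0} \<subseteq> ?N"
    using subst_congruent[OF N \<sigma>A] by fastforce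
  ultimately show ?thesis by blast
qed

text \<open>
  One more difference merges two classes: the representative \<open>var c\<close> of one of them is replaced
  throughout by the representative \<open>t\<close> of the other, where \<open>t = 0\<close> if that class meets \<open>U\<close>.
\<close>

lemma collapsing_step:
  fixes \<sigma> :: "'v \<Rightarrow> ('v, 'k::field) mpol"
  assumes \<sigma>: "collapsing A U S \<sigma>" and b: "b = var x - var y" "x \<in> A" "y \<in> A"
    and c: "{\<sigma> x, \<sigma> y} = {var c, t}" "t \<noteq> var c"
    and S: "S \<subseteq> {var x - var y | x y. x \<in> A \<and> y \<in> A}"
  shows "collapsing A U (insert b S) (\<lambda>a. if \<sigma> a = var c then t else \<sigma> a)"
proof -
  let ?\<sigma> = "\<lambda>a. if \<sigma> a = var c then t else \<sigma> a" and ?W = "pol.span (var ` U \<union> insert b S)"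
  have W: "pol.span (var ` U \<union> S) \<subseteq> ?W"
    by (intro pol.span_mono) auto
  have bW: "b \<in> ?W"
    by (intro pol.span_base) auto
  have xW: "var x - \<sigma> x \<in> ?W" and yW: "var y - \<sigma> y \<in> ?W"
    using \<sigma> b W unfolding collapsing_def by blast+
  have "\<sigma> x - \<sigma> y = b - (var x - \<sigma> x) + (var y - \<sigma> y)"
    by (simp add: b)
  also have "\<dots> \<in> ?W"
    by (rule pol.span_add[OF pol.span_diff[OF bW xW] yW])
  finally have d: "\<sigma> x - \<sigma> y \<in> ?W" .
  have "var c - t \<in> ?W"
  proof (cases "\<sigma> x = var c")
    case True
    then have "\<sigma> y = t"
      using c by (metis doubleton_eq_iff)
    then show ?thesis
      using d True by simp
  next
    case False
    then have "\<sigma> x = t" "\<sigma> y = var c"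
      using c by (metis doubleton_eq_iff)+
    then show ?thesis
      using pol.span_neg[OF d] by simp
  qed
  note ct = this
  have tA: "t \<in> insert 0 (var ` A)"
    using c \<sigma> b unfolding collapsing_def by (metis insertCI insertE singletonD)
  have "var a - ?\<sigma> a \<in> ?W" if a: "a \<in> A" for a
  proof (cases "\<sigma> a = var c")
    case True
    have "var a - \<sigma> a \<in> ?W"
      using \<sigma> a W unfolding collapsing_def by blast
    then have "(var a - \<sigma> a) + (var c - t) \<in> ?W"
      using ct by (rule pol.span_add)
    then show ?thesis
      using True by simp
  next
    case False
    then show ?thesis
      using \<sigma> a W unfolding collapsing_def by auto
  qed
  moreover have "subst ?\<sigma> f = 0" if f: "f \<in> S" for f
  proof -
    obtain u v where f': "f = var u - var v"
      using S f by blast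
    then have "\<sigma> u = \<sigma> v"
      using \<sigma> f by (auto simp: collapsing_def subst_diff subst_var)
    then show ?thesis
      by (simp add: f' subst_diff subst_var)
  qed
  moreover have "subst ?\<sigma> b = 0"
    using c by (auto simp: b(1) subst_diff subst_var doubleton_eq_iff)
  moreover have "?\<sigma> a = 0" if "a \<in> U" for a
  proof -
    have "var c \<noteq> (0 :: ('v, 'k) mpol)"
      by (metis keys_monomial_poly keys_zero var_def insert_not_empty)
    then show ?thesis
      using \<sigma> that by (auto simp: collapsing_def)
  qed
  ultimately show ?thesis
    using \<sigma> tA unfolding collapsing_def by auto
qed

lemma diff_mult_eq_0:
  fixes p q f :: "('v, 'k::field) mpol"
  assumes "p \<in> insert 0 (range var)" "q \<in> insert 0 (range var)" "p \<noteq> q" "(p - q) * f = 0"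
  shows "f = 0"
proof (cases "q = 0")
  case True
  then obtain a where "p = var a" using assms by auto
  then show ?thesis using assms(4) True var_mult_eq_0[of a f] by simp
next
  case False
  then obtain b where b: "q = var b" using assms by auto
  show ?thesis
  proof (cases "p = 0")
    case True
    then show ?thesis using assms(4) b var_mult_eq_0[of b f] by simp
  next
    case False
    then obtain a where "p = var a" using assms by auto
    then show ?thesis using assms(3,4) b var_diff_mult_eq_0[of a b f] by auto
  qed
qed

text \<open>
  Modulo the variables in \<open>U\<close> and the preceding differences, the next difference
  \<open>var x - var y\<close> becomes \<open>\<sigma> x - \<sigma> y\<close> in a polynomial ring. It does not vanish, since
  otherwise the difference would lie in the span of \<open>U\<close> and its predecessors, against
  independence. So it is, up to sign, a variable or a difference of two distinct variables, and
  these are nonzerodivisors.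
\<close>

lemma regular_on_differences:
  fixes bs :: "('v, 'k::field) mpol list"
  assumes U: "U \<subseteq> A"
    and "set bs \<subseteq> {var x - var y | x y. x \<in> A \<and> y \<in> A}" "distinct bs"
    and "pol.independent (set bs)" "pol.span (set bs) \<inter> pol.span (var ` U) = {0}"
  shows "comm_subring.regular_on (polys A) (monomial_ideal A (\<lambda>m. Poly_Mapping.keys m \<inter> U \<noteq> {})) bs"
proof -
  interpret comm_subring "polys A :: ('v, 'k) mpol set" by (rule comm_subring_polys)
  let ?Q = "monomial_ideal A (\<lambda>m. Poly_Mapping.keys m \<inter> U \<noteq> {}) :: ('v, 'k) mpol set"
  have "regular_on ?Q bs \<and> (\<exists>\<sigma>. collapsing A U (set bs) \<sigma>)"
    using assms(2-)
  proof (induction bs)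
    case Nil
    have "collapsing A U {} (\<lambda>a. if a \<in> U then 0 else (var a :: ('v, 'k) mpol))"
      using U by (auto simp: collapsing_def pol.span_zero intro: pol.span_base)
    then show ?case by auto
  next
    case (Cons b bs)
    have ind: "pol.independent (set bs)"
      using Cons.prems(3) by (rule pol.independent_mono) auto
    have sub: "pol.span (set bs) \<subseteq> pol.span (set (b # bs))"
      by (intro pol.span_mono) auto
    have "pol.span (set bs) \<inter> pol.span (var ` U) = {0}"
      using Cons.prems(4) sub pol.span_zero by blast
    then obtain \<sigma> where \<sigma>: "collapsing A U (set bs) \<sigma>" and reg: "regular_on ?Q bs"
      using Cons ind by auto
    obtain x y where b: "b = var x - var y" "x \<in> A" "y \<in> A"
      using Cons.prems by auto
    have bsC: "set bs \<subseteq> polys A"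
    proof
      fix f assume "f \<in> set bs"
      then obtain x y where "f = var x - var y" "x \<in> A" "y \<in> A"
        using Cons.prems(1) by auto
      then show "f \<in> polys A"
        using diff_mem var_mem_polys by metis
    qed
    have notin: "b \<notin> pol.span (var ` U \<union> set bs)"
    proof
      assume "b \<in> pol.span (var ` U \<union> set bs)"
      then obtain g k where gk: "b = g + k" "g \<in> pol.span (var ` U)" "k \<in> pol.span (set bs)"
        unfolding pol.span_Un by auto
      have "b \<in> pol.span (set (b # bs))"
        by (rule pol.span_base) simp
      then have "b - k \<in> pol.span (set (b # bs))"
        using gk(3) sub by (intro pol.span_diff) auto
      then have "g = 0"
        using gk Cons.prems(4) by auto
      then have "b \<in> pol.span (set bs)"
        using gk by simp
      moreover have "set (b # bs) - {b} = set bs"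
        using Cons.prems(2) by auto
      ultimately show False
        using Cons.prems(3) unfolding pol.dependent_def by (metis list.set_intros(1))
    qed
    have ne: "\<sigma> x \<noteq> \<sigma> y"
    proof
      assume "\<sigma> x = \<sigma> y"
      then have "subst \<sigma> b = 0"
        by (simp add: b subst_diff subst_var)
      moreover have "b \<in> pol.span (var ` A)"
        unfolding b(1) by (intro pol.span_diff pol.span_base) (use b in auto)
      ultimately show False
        using subst_span[of A \<sigma> "var ` U \<union> set bs" b] \<sigma> notin by (auto simp: collapsing_def)
    qed
    have range: "\<sigma> x \<in> insert 0 (var ` A)" "\<sigma> y \<in> insert 0 (var ` A)"
      using \<sigma> b by (auto simp: collapsing_def)
    have sub_range: "insert 0 (var ` A) \<subseteq> insert (0 :: ('v, 'k) mpol) (range var)"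
      by auto
    have "f \<in> combinations (polys A) ?Q bs"
      if f: "f \<in> polys A" "b * f \<in> combinations (polys A) ?Q bs" for f
    proof -
      have "subst \<sigma> (b * f) = 0"
        using f(2) unfolding combinations_eq_kernel[OF \<sigma> U bsC] by blast
      then have "(\<sigma> x - \<sigma> y) * subst \<sigma> f = 0"
        by (simp add: subst_mult subst_diff subst_var b(1))
      then have "subst \<sigma> f = 0"
        by (rule diff_mult_eq_0[OF subsetD[OF sub_range range(1)] subsetD[OF sub_range range(2)] ne])
      then show ?thesis
        using f(1) unfolding combinations_eq_kernel[OF \<sigma> U bsC] by blast
    qed
    moreover obtain c t where "{\<sigma> x, \<sigma> y} = {var c, t}" "t \<noteq> var c"
    proof (cases "\<sigma> x = 0")
      case True
      then obtain d where "\<sigma> y = var d"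
        using range(2) ne by auto
      then show ?thesis
        using ne that[of d "\<sigma> x"] by auto
    next
      case False
      then obtain d where "\<sigma> x = var d"
        using range(1) by auto
      then show ?thesis
        using ne that[of d "\<sigma> y"] by auto
    qed
    then have "\<exists>\<sigma>. collapsing A U (insert b (set bs)) \<sigma>"
      using collapsing_step[OF \<sigma> b] Cons.prems(1) by (metis (no_types, lifting) insert_subset list.simps(15))
    ultimately show ?case
      using reg by simp
  qed
  then show ?thesis by blast
qed

section \<open>Ideals of the polynomial ring\<close>

lemma carrier_poly_ring: "carrier (poly_ring A) = polys A"
  by (simp add: polys_def)

lemma ideal_poly_ring_iff:
  "ideal N (poly_ring A :: ('v, 'k::field) mpol ring) \<longleftrightarrow> comm_subring.is_ideal (polys A) N"
proof -
  let ?R = "poly_ring A :: ('v, 'k) mpol ring"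
  interpret comm_subring "polys A :: ('v, 'k) mpol set" by (rule comm_subring_polys)
  interpret R: cring ?R by (rule poly_ring_cring)
  show ?thesis
  proof
    assume N: "ideal N ?R"
    interpret N: ideal N ?R by (rule N)
    show "is_ideal N"
      unfolding is_ideal_def
    proof (intro conjI ballI)
      show "N \<subseteq> polys A" "0 \<in> N"
        using N.a_subset N.zero_closed by (simp_all only: carrier_poly_ring poly_ring_simps(5))
    next
      fix x y assume "x \<in> N" "y \<in> N"
      then show "x + y \<in> N"
        using N.a_closed[of x y] by (simp only: poly_ring_simps(3))
    next
      fix c x :: "('v, 'k) mpol" assume "c \<in> polys A" "x \<in> N"
      then show "c * x \<in> N"
        using N.I_l_closed[of x c] by (simp only: carrier_poly_ring poly_ring_simps(2))
    qed
  next
    assume N: "is_ideal N"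
    note ND = is_idealD[OF N]
    show "ideal N ?R"
    proof (rule idealI)
      show "subgroup N (add_monoid ?R)"
      proof (rule subgroup.intro)
        fix x assume x: "x \<in> N"
        then have "- x \<in> N"
          using ND(5)[OF ND(2) x] by simp
        moreover have "\<ominus>\<^bsub>?R\<^esub> x = - x"
          by (rule R.minus_equality)
            (use ND(1) x uminus_mem in \<open>auto simp: carrier_poly_ring simp del: poly_ring_simps(1)\<close>)
        ultimately show "inv\<^bsub>add_monoid ?R\<^esub> x \<in> N"
          by (simp add: a_inv_def)
      qed (use ND(1-3) in \<open>auto simp: carrier_poly_ring simp del: poly_ring_simps(1)\<close>)
    next
      fix a x assume "a \<in> N" "x \<in> carrier ?R"
      then have "x * a \<in> N"
        using ND(4)[of x a] by (simp only: carrier_poly_ring)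
      then show "x \<otimes>\<^bsub>?R\<^esub> a \<in> N" "a \<otimes>\<^bsub>?R\<^esub> x \<in> N"
        by (simp_all add: mult.commute)
    qed (rule R.ring_axioms)
  qed
qed

lemma genideal_monomials:
  assumes M: "up_closed M"
  shows "Idl\<^bsub>poly_ring A\<^esub> {monomial_poly m | m. m \<in> monomials_in A \<and> M m}
    = (monomial_ideal A M :: ('v, 'k::field) mpol set)"
proof
  interpret comm_subring "polys A :: ('v, 'k) mpol set" by (rule comm_subring_polys)
  interpret R: cring "poly_ring A :: ('v, 'k) mpol ring" by (rule poly_ring_cring)
  let ?G = "{monomial_poly m | m. m \<in> monomials_in A \<and> M m} :: ('v, 'k) mpol set"
  let ?N = "Idl\<^bsub>poly_ring A\<^esub> ?G"
  show "?N \<subseteq> monomial_ideal A M"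
  proof (rule R.genideal_minimal)
    show "ideal (monomial_ideal A M) (poly_ring A :: ('v, 'k) mpol ring)"
      unfolding ideal_poly_ring_iff using M by (rule is_ideal_monomial_ideal)
  qed (auto simp: monomial_ideal_def)
  have G: "?G \<subseteq> carrier (poly_ring A)"
    by auto
  have "is_ideal ?N"
    unfolding ideal_poly_ring_iff[symmetric] using G by (rule R.genideal_ideal)
  note ND = is_idealD[OF this]
  show "monomial_ideal A M \<subseteq> ?N"
  proof
    fix f :: "('v, 'k) mpol" assume "f \<in> monomial_ideal A M"
    then show "f \<in> ?N"
    proof (induction f rule: poly_mapping_single_induct)
      case zero
      show ?case by (rule ND(2))
    next
      case (single_add m c f)
      then have m: "m \<in> monomials_in A" "M m" and "f \<in> monomial_ideal A M"
        by (auto simp: monomial_ideal_def keys_single_add)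
      then have f: "f \<in> ?N"
        using single_add.IH by simp
      have "monomial_poly m \<in> ?N"
        using R.genideal_self[OF G] m by blast
      then have "Poly_Mapping.single 0 c * monomial_poly m \<in> ?N"
        using const_mem_polys by (rule ND(4)[rotated])
      then have "Poly_Mapping.single m c \<in> ?N"
        by (simp add: monomial_poly_def mult_single)
      then show ?case
        using f by (rule ND(3))
    qed
  qed
qed

lemma combinations_eq_genideal:
  fixes I :: "('v, 'k::field) mpol set"
  assumes I: "comm_subring.is_ideal (polys A) I" and bs: "set bs \<subseteq> polys A"
  shows "comm_subring.combinations (polys A) I bs = Idl\<^bsub>poly_ring A\<^esub> (I \<union> set bs)"
proof
  interpret comm_subring "polys A :: ('v, 'k) mpol set" by (rule comm_subring_polys)
  interpret R: cring "poly_ring A :: ('v, 'k) mpol ring" by (rule poly_ring_cring)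
  have G: "I \<union> set bs \<subseteq> carrier (poly_ring A)"
    unfolding carrier_poly_ring using bs is_idealD(1)[OF I] by simp
  have "is_ideal (Idl\<^bsub>poly_ring A\<^esub> (I \<union> set bs))"
    unfolding ideal_poly_ring_iff[symmetric] using G by (rule R.genideal_ideal)
  then show "combinations (polys A) I bs \<subseteq> Idl\<^bsub>poly_ring A\<^esub> (I \<union> set bs)"
    using R.genideal_self[OF G] by (intro combinations_subset) auto
  show "Idl\<^bsub>poly_ring A\<^esub> (I \<union> set bs) \<subseteq> combinations (polys A) I bs"
  proof (intro R.genideal_minimal Un_least)
    show "ideal (combinations (polys A) I bs) (poly_ring A :: ('v, 'k) mpol ring)"
      unfolding ideal_poly_ring_iff using is_ideal_combinations[OF is_ideal_self I bs] .
  qed (use combinations_base[OF zero_mem] combinations_generator[OF I] in blast)+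
qed

text \<open>
  The reversal accounts for \<open>regular_on\<close> keeping the last element of a sequence at the head.
\<close>

lemma (in comm_subring) regular_on_rev_nth:
  assumes "regular_on I (rev bs)" "i < length bs" "f \<in> C"
    and "bs ! i * f \<in> combinations C I (rev (take i bs))"
  shows "f \<in> combinations C I (rev (take i bs))"
  using assms
proof (induction bs rule: rev_induct)
  case (snoc b bs)
  show ?case
  proof (cases "i < length bs")
    case True
    then show ?thesis
      using snoc by (simp add: nth_append)
  next
    case False
    then have "i = length bs"
      using snoc.prems by simp
    then show ?thesis
      using snoc.prems by simp
  qed
qed simp

lemma regular_sequence_poly_ring:
  fixes I :: "('v, 'k::field) mpol set"
  assumes I: "comm_subring.is_ideal (polys A) I" and bs: "set bs \<subseteq> polys A"
    and reg: "comm_subring.regular_on (polys A) I (rev bs)"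
  shows "regular_sequence (poly_ring A Quot I) (map (\<lambda>b. I +>\<^bsub>poly_ring A\<^esub> b) bs)"
proof -
  interpret comm_subring "polys A :: ('v, 'k) mpol set" by (rule comm_subring_polys)
  interpret R: cring "poly_ring A :: ('v, 'k) mpol ring" by (rule poly_ring_cring)
  show ?thesis
  proof (rule R.regular_sequence_Quot)
    show "ideal I (poly_ring A)"
      unfolding ideal_poly_ring_iff by (rule I)
    show "set bs \<subseteq> carrier (poly_ring A)"
      unfolding carrier_poly_ring by (rule bs)
    fix i f
    assume i: "i < length bs" and f: "f \<in> carrier (poly_ring A)"
      and bf: "bs ! i \<otimes>\<^bsub>poly_ring A\<^esub> f \<in> Idl\<^bsub>poly_ring A\<^esub> (I \<union> set (take i bs))"
    have "set (rev (take i bs)) \<subseteq> polys A"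
      using bs set_take_subset[of i bs] by auto
    from combinations_eq_genideal[OF I this]
    have eq: "combinations (polys A) I (rev (take i bs)) = Idl\<^bsub>poly_ring A\<^esub> (I \<union> set (take i bs))"
      by simp
    show "f \<in> Idl\<^bsub>poly_ring A\<^esub> (I \<union> set (take i bs))"
      using regular_on_rev_nth[OF reg i, of f] f bf
      unfolding eq carrier_poly_ring poly_ring_simps(2) by blast
  qed
qed

section \<open>The letterplace ideal\<close>

definition map_graph :: "'p set \<Rightarrow> ('p \<Rightarrow> nat) \<Rightarrow> (nat \<times> 'p) set" where
  "map_graph P \<psi> = (\<lambda>p. (\<psi> p, p)) ` P"

text \<open>
  By Alexander duality the letterplace ideal is the intersection, over \<open>\<psi> \<in> J\<close>, of the prime
  ideals generated by the variables on the graph of \<open>\<psi>\<close>; this is the condition on the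
  monomials of that intersection.
\<close>

definition meets_graphs :: "'p set \<Rightarrow> ('p \<Rightarrow> nat) set \<Rightarrow> (nat \<times> 'p \<Rightarrow>\<^sub>0 nat) \<Rightarrow> bool" where
  "meets_graphs P J m \<longleftrightarrow> (\<forall>\<psi>\<in>J. Poly_Mapping.keys m \<inter> map_graph P \<psi> \<noteq> {})"

lemma up_closed_meets_graphs: "up_closed (meets_graphs P J)"
  by (auto simp: up_closed_def meets_graphs_def keys_add_nat Int_Un_distrib2)

lemma monomial_poly_dvd:
  assumes "(monomial_poly d :: ('v, 'k::field) mpol) dvd monomial_poly m"
  shows "\<exists>u. m = d + u"
proof -
  obtain g :: "('v, 'k) mpol" where "monomial_poly m = monomial_poly d * g"
    using assms by (auto elim: dvdE)
  then have "m \<in> Poly_Mapping.keys (monomial_poly d * g)"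
    by (metis insertI1 keys_monomial_poly)
  then show ?thesis
    using Poly_Mapping.keys_mult[of "monomial_poly d" g] by auto
qed

lemma single_dvd_monomial_poly:
  assumes "a \<in> Poly_Mapping.keys m"
  shows "(monomial_poly (Poly_Mapping.single a 1) :: ('v, 'k::field) mpol) dvd monomial_poly m"
  using monomial_decomp_var[OF assms] monomial_poly_add by (metis dvd_triv_left)

lemma lookup_sum_singles:
  assumes "finite V"
  shows "Poly_Mapping.lookup (\<Sum>x\<in>V. Poly_Mapping.single x (1::nat)) y = (if y \<in> V then 1 else 0)"
proof -
  have "Poly_Mapping.lookup (\<Sum>x\<in>V. Poly_Mapping.single x (1::nat)) y = (\<Sum>x\<in>V. if y = x then 1 else 0)"
    unfolding lookup_sum by (intro sum.cong) (auto simp: lookup_single when_def)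
  then show ?thesis
    using assms by simp
qed

lemma keys_sum_singles:
  "finite V \<Longrightarrow> Poly_Mapping.keys (\<Sum>x\<in>V. Poly_Mapping.single x (1::nat)) = V"
  using lookup_sum_singles[of V] by (auto simp: in_keys_iff split: if_splits)

text \<open>
  A monomial of the co-letterplace ideal is divisible by the graph monomial of some \<open>\<psi> \<in> J\<close>.
  Hence it suffices to have a common factor with the graph monomials, and such a factor exists
  exactly when a variable of the graph occurs.
\<close>

lemma alexander_dual_co_letterplace:
  assumes P: "finite P" and J: "J \<subseteq> Hom_poset P n"
  shows "alexander_dual (P \<times> {1..n}) (co_letterplace P n J :: ('p::order \<times> nat, 'k::field) mpol set)
    = monomial_ideal (P \<times> {1..n}) (\<lambda>m. \<forall>\<psi>\<in>J. \<exists>p\<in>P. (p, \<psi> p) \<in> Poly_Mapping.keys m)"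
proof -
  let ?A = "P \<times> {1..n}"
  let ?I = "co_letterplace P n J :: ('p \<times> nat, 'k) mpol set"
  interpret R: cring "poly_ring ?A :: ('p \<times> nat, 'k) mpol ring" by (rule poly_ring_cring)
  let ?G = "{\<Prod>p\<in>P. var (p, \<psi> p) | \<psi>. \<psi> \<in> J} :: ('p \<times> nat, 'k) mpol set"
  let ?N = "\<lambda>m. \<exists>\<psi>\<in>J. (\<lambda>p. (p, \<psi> p)) ` P \<subseteq> Poly_Mapping.keys m"
  define u where "u \<psi> = (\<Sum>x\<in>(\<lambda>p. (p, \<psi> p)) ` P. Poly_Mapping.single x (1::nat))" for \<psi> :: "'p \<Rightarrow> nat"
  have keys_u: "Poly_Mapping.keys (u \<psi>) = (\<lambda>p. (p, \<psi> p)) ` P" for \<psi>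
    unfolding u_def using P by (intro keys_sum_singles) simp
  have prod: "(\<Prod>p\<in>P. var (p, \<psi> p) :: ('p \<times> nat, 'k) mpol) = monomial_poly (u \<psi>)" for \<psi>
    unfolding u_def monomial_poly_sum var_def by (subst prod.reindex) (auto intro: inj_onI)
  have uA: "u \<psi> \<in> monomials_in ?A" if "\<psi> \<in> J" for \<psi>
    using J that by (auto simp: monomials_in_def keys_u Hom_poset_def)
  have GN: "?G \<subseteq> monomial_ideal ?A ?N"
  proof
    fix f assume "f \<in> ?G"
    then obtain \<psi> where \<psi>: "\<psi> \<in> J" "f = monomial_poly (u \<psi>)"
      unfolding prod by blast
    have "?N (u \<psi>)"
      using \<psi>(1) keys_u[of \<psi>] by blast
    then show "f \<in> monomial_ideal ?A ?N"
      using uA[OF \<psi>(1)] by (simp add: \<psi>(2) monomial_ideal_def)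
  qed
  have N: "up_closed ?N"
    by (auto simp: up_closed_def keys_add_nat)
  have I: "?I \<subseteq> monomial_ideal ?A ?N"
    unfolding co_letterplace_def
    using GN N by (intro R.genideal_minimal) (simp_all only: ideal_poly_ring_iff is_ideal_monomial_ideal)
  have GI: "?G \<subseteq> ?I"
    unfolding co_letterplace_def
  proof (rule R.genideal_self)
    show "?G \<subseteq> carrier (poly_ring ?A)"
      using uA by (auto simp: prod)
  qed
  have "(\<forall>w. (monomial_poly w :: ('p \<times> nat, 'k) mpol) \<in> ?I \<longrightarrow>
           (\<exists>d. d \<noteq> 0 \<and> (monomial_poly d :: ('p \<times> nat, 'k) mpol) dvd monomial_poly m \<and>
                (monomial_poly d :: ('p \<times> nat, 'k) mpol) dvd monomial_poly w))
    \<longleftrightarrow> (\<forall>\<psi>\<in>J. \<exists>p\<in>P. (p, \<psi> p) \<in> Poly_Mapping.keys m)" (is "?L \<longleftrightarrow> ?R") for m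
  proof
    assume L: ?L
    show ?R
    proof
      fix \<psi> assume "\<psi> \<in> J"
      then have "(\<Prod>p\<in>P. var (p, \<psi> p) :: ('p \<times> nat, 'k) mpol) \<in> ?G"
        by blast
      then have "(monomial_poly (u \<psi>) :: ('p \<times> nat, 'k) mpol) \<in> ?I"
        using subsetD[OF GI] unfolding prod by blast
      then obtain d where d: "d \<noteq> 0" "(monomial_poly d :: ('p \<times> nat, 'k) mpol) dvd monomial_poly m"
        "(monomial_poly d :: ('p \<times> nat, 'k) mpol) dvd monomial_poly (u \<psi>)"
        using L by blast
      obtain a where a: "a \<in> Poly_Mapping.keys d"
        using d(1) keys_eq_empty by blast
      have "a \<in> Poly_Mapping.keys m"
        using monomial_poly_dvd[OF d(2)] a by (auto simp: keys_add_nat)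
      moreover have "a \<in> Poly_Mapping.keys (u \<psi>)"
        using monomial_poly_dvd[OF d(3)] a by (auto simp: keys_add_nat)
      ultimately show "\<exists>p\<in>P. (p, \<psi> p) \<in> Poly_Mapping.keys m"
        by (auto simp: keys_u)
    qed
  next
    assume R: ?R
    show ?L
    proof (intro allI impI)
      fix w assume "(monomial_poly w :: ('p \<times> nat, 'k) mpol) \<in> ?I"
      then have "(monomial_poly w :: ('p \<times> nat, 'k) mpol) \<in> monomial_ideal ?A ?N"
        using I by blast
      then obtain \<psi> where \<psi>: "\<psi> \<in> J" "(\<lambda>p. (p, \<psi> p)) ` P \<subseteq> Poly_Mapping.keys w"
        by (auto simp: monomial_ideal_def)
      then obtain p where p: "p \<in> P" "(p, \<psi> p) \<in> Poly_Mapping.keys m"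
        using R by blast
      show "\<exists>d. d \<noteq> 0 \<and> (monomial_poly d :: ('p \<times> nat, 'k) mpol) dvd monomial_poly m \<and>
          (monomial_poly d :: ('p \<times> nat, 'k) mpol) dvd monomial_poly w"
      proof (intro exI conjI)
        show "Poly_Mapping.single (p, \<psi> p) (1::nat) \<noteq> 0"
          by (metis keys_single keys_zero insert_not_empty one_neq_zero)
      qed (use p \<psi> in \<open>auto intro: single_dvd_monomial_poly simp del: One_nat_def\<close>)
    qed
  qed
  then have "alexander_dual ?A ?I = Idl\<^bsub>poly_ring ?A\<^esub> {monomial_poly m | m. m \<in> monomials_in ?A \<and>
      (\<forall>\<psi>\<in>J. \<exists>p\<in>P. (p, \<psi> p) \<in> Poly_Mapping.keys m)}"
    unfolding alexander_dual_def by simp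
  also have "\<dots> = monomial_ideal ?A (\<lambda>m. \<forall>\<psi>\<in>J. \<exists>p\<in>P. (p, \<psi> p) \<in> Poly_Mapping.keys m)"
    by (rule genideal_monomials) (auto simp: up_closed_def keys_add_nat)
  finally show ?thesis .
qed

lemma keys_map_key_swap: "Poly_Mapping.keys (Poly_Mapping.map_key prod.swap m) = prod.swap ` Poly_Mapping.keys m"
proof -
  have "x \<in> Poly_Mapping.keys (Poly_Mapping.map_key prod.swap m) \<longleftrightarrow> prod.swap x \<in> Poly_Mapping.keys m" for x
    by (simp add: in_keys_iff map_key.rep_eq)
  then show ?thesis
    by force
qed

lemma letterplace_eq:
  assumes "finite P" "J \<subseteq> Hom_poset P n"
  shows "(letterplace n P J :: (nat \<times> 'p::order, 'k::field) mpol set)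
    = monomial_ideal ({1..n} \<times> P) (meets_graphs P J)"
proof -
  have keys: "m \<in> Poly_Mapping.keys (swap_vars f) \<longleftrightarrow> Poly_Mapping.map_key prod.swap m \<in> Poly_Mapping.keys f"
    for f :: "('a \<times> 'b, 'k) mpol" and m
    by (simp add: in_keys_iff lookup_swap_vars)
  have inv: "swap_vars (swap_vars f) = f" for f :: "('a \<times> 'b, 'k) mpol"
    by (intro poly_mapping_eqI) (simp add: lookup_swap_vars map_key_swap_swap)
  have in_A: "Poly_Mapping.map_key prod.swap m \<in> monomials_in (Y \<times> X) \<longleftrightarrow> m \<in> monomials_in (X \<times> Y)"
    for m :: "'a \<times> 'b \<Rightarrow>\<^sub>0 nat" and X Y
    by (force simp: monomials_in_def keys_map_key_swap)
  have meets: "(\<forall>\<psi>\<in>J. \<exists>p\<in>P. (p, \<psi> p) \<in> Poly_Mapping.keys m)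
      \<longleftrightarrow> meets_graphs P J (Poly_Mapping.map_key prod.swap m)" for m
    by (force simp: meets_graphs_def map_graph_def keys_map_key_swap)
  let ?I = "monomial_ideal (P \<times> {1..n}) (\<lambda>m. \<forall>\<psi>\<in>J. \<exists>p\<in>P. (p, \<psi> p) \<in> Poly_Mapping.keys m) :: ('p \<times> nat, 'k) mpol set"
  have "swap_vars ` ?I = monomial_ideal ({1..n} \<times> P) (meets_graphs P J)"
  proof (intro equalityI subsetI)
    fix f :: "(nat \<times> 'p, 'k) mpol"
    assume "f \<in> monomial_ideal ({1..n} \<times> P) (meets_graphs P J)"
    then have "swap_vars f \<in> ?I"
      unfolding monomial_ideal_def
      by (auto simp: keys meets in_A[symmetric, where X="P"] in_A[symmetric, where X="{1..n}"] map_key_swap_swap)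
    then show "f \<in> swap_vars ` ?I"
      using inv[of f] by (intro image_eqI[of _ _ "swap_vars f"]) simp_all
  next
    fix f :: "(nat \<times> 'p, 'k) mpol"
    assume "f \<in> swap_vars ` ?I"
    then obtain g where g: "g \<in> ?I" "f = swap_vars g" by blast
    show "f \<in> monomial_ideal ({1..n} \<times> P) (meets_graphs P J)"
      unfolding monomial_ideal_def
    proof (intro CollectI ballI)
      fix m assume "m \<in> Poly_Mapping.keys f"
      then have "Poly_Mapping.map_key prod.swap m \<in> Poly_Mapping.keys g"
        by (simp add: g keys)
      then show "m \<in> monomials_in ({1..n} \<times> P) \<and> meets_graphs P J m"
        using g(1) by (auto simp: monomial_ideal_def meets in_A map_key_swap_swap)
    qed
  qed
  then show ?thesis
    unfolding letterplace_def alexander_dual_co_letterplace[OF assms] .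
qed

section \<open>Removing a maximal isotone map\<close>

lemma ex_maximal_isotone:
  assumes "finite P" "finite J" "J \<noteq> {}" "J \<subseteq> Hom_poset P n"
  shows "\<exists>\<psi>\<in>J. \<forall>\<chi>\<in>J. le_on P \<psi> \<chi> \<longrightarrow> \<chi> = \<psi>"
proof -
  have "Max ((\<lambda>\<psi>. sum \<psi> P) ` J) \<in> (\<lambda>\<psi>. sum \<psi> P) ` J"
    using assms by (intro Max_in) auto
  then obtain \<psi> where \<psi>: "\<psi> \<in> J" "sum \<psi> P = Max ((\<lambda>\<psi>. sum \<psi> P) ` J)"
    by auto
  have "\<chi> = \<psi>" if \<chi>: "\<chi> \<in> J" and le: "le_on P \<psi> \<chi>" for \<chi>
  proof (rule PiE_ext)
    show "\<chi> \<in> P \<rightarrow>\<^sub>E {1..n}" "\<psi> \<in> P \<rightarrow>\<^sub>E {1..n}"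
      using \<chi> \<psi>(1) assms(4) by (auto simp: Hom_poset_def)
    fix p assume p: "p \<in> P"
    have "sum \<chi> P \<le> sum \<psi> P"
      unfolding \<psi>(2) using \<chi> assms(2) by (intro Max_ge) auto
    moreover have "sum \<psi> P < sum \<chi> P" if "\<psi> p < \<chi> p"
      using le p that assms(1) by (intro sum_strict_mono_ex1) (auto simp: le_on_def)
    ultimately show "\<chi> p = \<psi> p"
      using le p by (force simp: le_on_def)
  qed
  then show ?thesis
    using \<psi>(1) by blast
qed

text \<open>
  The product of these variables is the monomial \<open>v\<close> to which \<open>regular_on_Int\<close> is applied.
  Dually, they generate the colon ideal of the co-letterplace ideal of \<open>J - {\<psi>}\<close> by the graph
  monomial of \<open>\<psi>\<close> when \<open>\<psi>\<close> is maximal in \<open>J\<close>.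
\<close>

definition lowerings :: "'p set \<Rightarrow> ('p \<Rightarrow> nat) set \<Rightarrow> ('p \<Rightarrow> nat) \<Rightarrow> (nat \<times> 'p) set" where
  "lowerings P J \<psi> = {(i, p). p \<in> P \<and> i < \<psi> p \<and> \<psi>(p := i) \<in> J}"

lemma lowerings_subset: "J \<subseteq> Hom_poset P n \<Longrightarrow> lowerings P J \<psi> \<subseteq> {1..n} \<times> P"
  unfolding lowerings_def Hom_poset_def PiE_iff by fastforce

text \<open>
  As \<open>\<psi>\<close> is maximal, \<open>\<chi>\<close> lies below \<open>\<psi>\<close> at some point; take \<open>p\<close> minimal among these.
  Lowering \<open>\<psi>\<close> to \<open>\<chi> p\<close> at \<open>p\<close> alone keeps it isotone, because for \<open>q < p\<close> minimality gives
  \<open>\<psi> q \<le> \<chi> q \<le> \<chi> p\<close>. The result stays in the poset ideal \<open>J\<close>, so \<open>(\<chi> p, p)\<close> is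
  a lowering. In ideal terms, the product of the lowerings lies in the ideal for
  \<open>J - {\<psi>}\<close>.
\<close>

lemma graph_meets_lowerings:
  fixes P :: "'p::order set"
  assumes P: "finite P" and J: "poset_ideal (Hom_poset P n) (le_on P) J"
    and \<psi>: "\<psi> \<in> J" "\<And>\<chi>. \<chi> \<in> J \<Longrightarrow> le_on P \<psi> \<chi> \<Longrightarrow> \<chi> = \<psi>"
    and \<chi>: "\<chi> \<in> J" "\<chi> \<noteq> \<psi>"
  shows "lowerings P J \<psi> \<inter> map_graph P \<chi> \<noteq> {}"
proof -
  have JH: "J \<subseteq> Hom_poset P n"
    using J by (simp add: poset_ideal_def)
  let ?D = "{p \<in> P. \<chi> p < \<psi> p}"
  have "\<not> le_on P \<psi> \<chi>"
    using \<psi> \<chi> by blast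
  then have "?D \<noteq> {}" "finite ?D"
    using P by (auto simp: le_on_def not_le)
  then obtain p where p: "p \<in> ?D" and min: "\<And>q. q \<in> ?D \<Longrightarrow> q \<le> p \<Longrightarrow> p = q"
    by (meson finite_has_minimal)
  let ?\<theta> = "\<psi>(p := \<chi> p)"
  have h: "\<psi> \<in> P \<rightarrow>\<^sub>E {1..n}" "\<chi> \<in> P \<rightarrow>\<^sub>E {1..n}"
    and mono: "monotone_on P (\<le>) (\<le>) \<psi>" "monotone_on P (\<le>) (\<le>) \<chi>"
    using JH \<psi>(1) \<chi>(1) by (auto simp: Hom_poset_def)
  have "monotone_on P (\<le>) (\<le>) ?\<theta>"
  proof (rule monotone_onI)
    fix a b assume ab: "a \<in> P" "b \<in> P" "a \<le> b"
    have \<psi>ab: "\<psi> a \<le> \<psi> b" and \<chi>ab: "\<chi> a \<le> \<chi> b"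
      using mono ab by (auto simp: monotone_on_def)
    consider "b = p" "a \<noteq> p" | "b \<noteq> p" | "a = p" "b = p" by blast
    then show "?\<theta> a \<le> ?\<theta> b"
    proof cases
      case 1
      then have "\<not> \<chi> a < \<psi> a"
        using min[of a] ab by auto
      then show ?thesis
        using 1 \<chi>ab by simp
    next
      case 2
      then show ?thesis
        using \<psi>ab p by auto
    qed simp
  qed
  moreover have "?\<theta> \<in> P \<rightarrow>\<^sub>E {1..n}"
    using h p by (auto simp: PiE_iff extensional_def)
  ultimately have "?\<theta> \<in> Hom_poset P n"
    by (simp add: Hom_poset_def)
  moreover have "le_on P ?\<theta> \<psi>"
    using p by (simp add: le_on_def)
  ultimately have "?\<theta> \<in> J"
    using J \<psi>(1) unfolding poset_ideal_def by blast
  then have "(\<chi> p, p) \<in> lowerings P J \<psi> \<inter> map_graph P \<chi>"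
    using p by (auto simp: lowerings_def map_graph_def)
  then show ?thesis by blast
qed

text \<open>
  A monomial that misses the graph of \<open>\<psi>\<close> can meet the graph of \<open>\<psi>(p := i)\<close> only at the one
  point where the two graphs differ. In ideal terms, modulo the prime of \<open>\<psi>\<close> every element
  of the ideal for \<open>J - {\<psi>}\<close> is a multiple of the product of the lowerings.
\<close>

lemma lowerings_subset_keys:
  assumes \<psi>: "\<psi> \<in> J" and m: "meets_graphs P (J - {\<psi>}) m" "Poly_Mapping.keys m \<inter> map_graph P \<psi> = {}"
  shows "lowerings P J \<psi> \<subseteq> Poly_Mapping.keys m"
proof
  fix x assume "x \<in> lowerings P J \<psi>"
  then obtain i p where x: "x = (i, p)" "p \<in> P" "i < \<psi> p" "\<psi>(p := i) \<in> J"
    by (auto simp: lowerings_def)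
  then have "\<psi>(p := i) \<in> J - {\<psi>}"
    by (auto dest: fun_cong[of _ _ p])
  then obtain q where q: "q \<in> P" "((\<psi>(p := i)) q, q) \<in> Poly_Mapping.keys m"
    using m(1) unfolding meets_graphs_def map_graph_def by blast
  have "(\<psi> q, q) \<notin> Poly_Mapping.keys m"
    using q(1) m(2) by (auto simp: map_graph_def)
  then have "q = p"
    using q(2) by (auto split: if_splits)
  then show "x \<in> Poly_Mapping.keys m"
    using q(2) x(1) by simp
qed

text \<open>
  Induction on \<open>J\<close>, which remains a poset ideal when a maximal element is removed. The two
  preceding lemmas provide the hypotheses of \<open>regular_on_Int\<close>. For empty \<open>J\<close> the ideal is
  the whole ring.
\<close>

lemma regular_on_meets_graphs:
  fixes P :: "'p::order set" and bs :: "(nat \<times> 'p, 'k::field) mpol list"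
  assumes P: "finite P" and J: "poset_ideal (Hom_poset P n) (le_on P) J"
    and bs: "set bs \<subseteq> polys ({1..n} \<times> P)"
    and prime: "\<And>\<psi>. \<psi> \<in> J \<Longrightarrow> comm_subring.regular_on (polys ({1..n} \<times> P))
      (monomial_ideal ({1..n} \<times> P) (\<lambda>m. Poly_Mapping.keys m \<inter> map_graph P \<psi> \<noteq> {})) bs"
  shows "comm_subring.regular_on (polys ({1..n} \<times> P))
      (monomial_ideal ({1..n} \<times> P) (meets_graphs P J)) bs"
proof -
  let ?A = "{1..n} \<times> P"
  let ?C = "polys ?A :: (nat \<times> 'p, 'k) mpol set"
  interpret comm_subring ?C by (rule comm_subring_polys)
  have "finite (Hom_poset P n)"
    by (rule finite_subset[of _ "P \<rightarrow>\<^sub>E {1..n}"]) (auto simp: Hom_poset_def P intro: finite_PiE)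
  then have "finite J"
    using J by (auto simp: poset_ideal_def intro: finite_subset)
  then show ?thesis
    using J prime
  proof (induction J rule: finite_psubset_induct)
    case (psubset J)
    show ?case
    proof (cases "J = {}")
      case True
      then have "monomial_ideal ?A (meets_graphs P J) = ?C"
        by (auto simp: monomial_ideal_def meets_graphs_def polys_def)
      then show ?thesis
        using regular_on_self[OF bs] by simp
    next
      case False
      have JH: "J \<subseteq> Hom_poset P n"
        using psubset.prems(1) by (simp add: poset_ideal_def)
      obtain \<psi> where \<psi>: "\<psi> \<in> J" and max: "\<And>\<chi>. \<chi> \<in> J \<Longrightarrow> le_on P \<psi> \<chi> \<Longrightarrow> \<chi> = \<psi>"
        using ex_maximal_isotone[OF P psubset.hyps False JH] by blast
      let ?I = "monomial_ideal ?A (meets_graphs P (J - {\<psi>})) :: (nat \<times> 'p, 'k) mpol set"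
      let ?Q = "monomial_ideal ?A (\<lambda>m. Poly_Mapping.keys m \<inter> map_graph P \<psi> \<noteq> {}) :: (nat \<times> 'p, 'k) mpol set"
      let ?V = "lowerings P J \<psi>"
      define w where "w = (\<Sum>x\<in>?V. Poly_Mapping.single x (1::nat))"
      have VA: "?V \<subseteq> ?A"
        using JH by (rule lowerings_subset)
      then have finV: "finite ?V"
        using P by (auto intro: finite_subset)
      have keys_w: "Poly_Mapping.keys w = ?V"
        unfolding w_def using finV by (rule keys_sum_singles)
      have I: "is_ideal ?I"
        by (intro is_ideal_monomial_ideal up_closed_meets_graphs)
      have Q: "is_ideal ?Q"
        by (rule is_ideal_monomial_ideal) (auto simp: up_closed_def keys_add_nat)
      have "poset_ideal (Hom_poset P n) (le_on P) (J - {\<psi>})"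
        using psubset.prems(1) max unfolding poset_ideal_def by blast
      then have regI: "regular_on ?I bs"
        using psubset.IH[of "J - {\<psi>}"] psubset.prems(2) \<psi> by blast
      have v: "monomial_poly w \<in> ?I"
        using VA graph_meets_lowerings[OF P psubset.prems(1) \<psi> max]
        by (auto simp: monomial_ideal_def meets_graphs_def keys_w monomials_in_def)
      have dec: "\<exists>q\<in>?Q. \<exists>s\<in>?C. f = q + s * monomial_poly w" if "f \<in> ?I" for f
        using that
      proof (induction f rule: poly_mapping_single_induct)
        case zero
        show ?case
          using is_idealD(2)[OF Q] zero_mem by (intro bexI[of _ 0]) auto
      next
        case (single_add m c f)
        then have m: "m \<in> monomials_in ?A" "meets_graphs P (J - {\<psi>}) m" and "f \<in> ?I"
          by (auto simp: monomial_ideal_def keys_single_add)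
        then obtain q s where qs: "q \<in> ?Q" "s \<in> ?C" "f = q + s * monomial_poly w"
          using single_add.IH by blast
        show ?case
        proof (cases "Poly_Mapping.keys m \<inter> map_graph P \<psi> = {}")
          case False
          then have "Poly_Mapping.single m c \<in> ?Q"
            using m(1) by (simp add: monomial_ideal_def)
          then have "Poly_Mapping.single m c + q \<in> ?Q"
            using qs(1) by (rule is_idealD(3)[OF Q])
          then show ?thesis
            using qs(2,3) by (intro bexI[of _ s] bexI[of _ "Poly_Mapping.single m c + q"]) (simp_all add: add.assoc)
        next
          case True
          then have "?V \<subseteq> Poly_Mapping.keys m"
            using lowerings_subset_keys[OF \<psi> m(2)] by blast
          then have m_eq: "m = (m - w) + w"
            by (intro poly_mapping_eqI)
              (auto simp: lookup_add lookup_minus w_def lookup_sum_singles[OF finV] in_keys_iff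
                simp del: One_nat_def)
          have "Poly_Mapping.keys (m - w) \<subseteq> Poly_Mapping.keys m"
            by (auto simp: in_keys_iff lookup_minus)
          then have "m - w \<in> monomials_in ?A"
            using m(1) by (auto simp: monomials_in_def)
          then have "Poly_Mapping.single (m - w) c + s \<in> ?C"
            using qs(2) by (intro add_mem single_mem_polys)
          moreover have "Poly_Mapping.single m c = Poly_Mapping.single (m - w) c * monomial_poly w"
            unfolding monomial_poly_def mult_single using m_eq by simp
          then have "Poly_Mapping.single m c + f = q + (Poly_Mapping.single (m - w) c + s) * monomial_poly w"
            by (simp add: qs(3) algebra_simps)
          ultimately show ?thesis
            using qs(1) by blast
        qed
      qed
      have cancel: "f \<in> ?Q" if f: "f \<in> ?C" "f * monomial_poly w \<in> ?Q" for f
        unfolding monomial_ideal_def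
      proof (intro CollectI ballI conjI)
        fix m assume m: "m \<in> Poly_Mapping.keys f"
        then show "m \<in> monomials_in ?A"
          using f(1) by (auto simp: polys_def)
        have "w + m \<in> Poly_Mapping.keys (f * monomial_poly w)"
          using m lookup_monomial_poly_mult[of w f m] by (simp add: in_keys_iff mult.commute)
        then have "Poly_Mapping.keys (w + m) \<inter> map_graph P \<psi> \<noteq> {}"
          using f(2) by (auto simp: monomial_ideal_def)
        moreover have "?V \<inter> map_graph P \<psi> = {}"
          by (auto simp: lowerings_def map_graph_def)
        ultimately show "Poly_Mapping.keys m \<inter> map_graph P \<psi> \<noteq> {}"
          by (auto simp: keys_add_nat keys_w)
      qed
      have "regular_on (?I \<inter> ?Q) bs"
        using I Q v dec cancel bs regI psubset.prems(2)[OF \<psi>] by (rule regular_on_Int)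
      moreover have "?I \<inter> ?Q = monomial_ideal ?A (meets_graphs P J)"
        unfolding monomial_ideal_Int using \<psi> by (auto simp: monomial_ideal_def meets_graphs_def)
      ultimately show ?thesis by simp
    qed
  qed
qed

section \<open>Linear forms on the graph of an isotone map\<close>

text \<open>
  Two points \<open>(\<psi> p, p)\<close> and \<open>(\<psi> q, q)\<close> of one fiber are comparable in \<open>[n] \<times> P\<^sup>o\<^sup>p\<close>, say
  \<open>\<psi> p \<le> \<psi> q\<close> and \<open>q \<le> p\<close>. If they were distinct, left strictness would give
  \<open>\<psi> p < \<psi> q\<close>, while \<open>\<psi>\<close> being isotone gives \<open>\<psi> q \<le> \<psi> p\<close>.
\<close>

lemma inj_on_graph:
  fixes \<phi> :: "nat \<times> 'p::order \<Rightarrow> 'r::order"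
  assumes \<phi>: "isotone_left_strict_chain_fibers n P R \<phi>" and \<psi>: "\<psi> \<in> Hom_poset P n"
  shows "inj_on \<phi> (map_graph P \<psi>)"
proof -
  have neq: False if pq: "p \<in> P" "q \<in> P" "p \<noteq> q" "\<phi> (\<psi> p, p) = \<phi> (\<psi> q, q)"
    and le: "rel_prod (\<le>) (\<ge>) (\<psi> p, p) (\<psi> q, q)" for p q
  proof -
    let ?F = "{x \<in> {1..n} \<times> P. \<phi> x = \<phi> (\<psi> p, p)}"
    have mem: "(\<psi> p, p) \<in> ?F" "(\<psi> q, q) \<in> ?F"
      using pq \<psi> by (auto simp: Hom_poset_def)
    then have "left_strict_chain (\<le>) (\<ge>) ?F"
      using \<phi> unfolding isotone_left_strict_chain_fibers_def by blast
    then have "\<psi> p \<noteq> \<psi> q"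
      using mem le pq(3) unfolding left_strict_chain_def by fastforce
    moreover have "\<psi> q \<le> \<psi> p"
      using \<psi> pq le by (auto simp: Hom_poset_def monotone_on_def)
    ultimately show False
      using le by simp
  qed
  show ?thesis
  proof (rule inj_onI, rule ccontr)
    fix x y assume xy: "x \<in> map_graph P \<psi>" "y \<in> map_graph P \<psi>" "\<phi> x = \<phi> y" "x \<noteq> y"
    then obtain p q where pq: "x = (\<psi> p, p)" "y = (\<psi> q, q)" "p \<in> P" "q \<in> P"
      by (auto simp: map_graph_def)
    let ?F = "{z \<in> {1..n} \<times> P. \<phi> z = \<phi> x}"
    have mem: "x \<in> ?F" "y \<in> ?F"
      using xy(3) pq \<psi> by (auto simp: Hom_poset_def)
    then have "left_strict_chain (\<le>) (\<ge>) ?F"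
      using \<phi> unfolding isotone_left_strict_chain_fibers_def by blast
    then have "rel_prod (\<le>) (\<ge>) x y \<or> rel_prod (\<le>) (\<ge>) y x"
      using mem unfolding left_strict_chain_def Complete_Partial_Order.chain_def by blast
    then show False
      using neq[of p q] neq[of q p] xy(3,4) pq by metis
  qed
qed

lemma keys_span_vars:
  assumes "f \<in> pol.span (var ` U :: ('v, 'k::field) mpol set)"
  shows "Poly_Mapping.keys f \<subseteq> (\<lambda>a. Poly_Mapping.single a 1) ` U"
proof -
  let ?S = "{f :: ('v, 'k) mpol. Poly_Mapping.keys f \<subseteq> (\<lambda>a. Poly_Mapping.single a 1) ` U}"
  have "pol.subspace ?S"
    unfolding pol.subspace_def
  proof (intro conjI ballI allI)
    fix f g :: "('v, 'k) mpol" assume "f \<in> ?S" "g \<in> ?S"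
    then show "f + g \<in> ?S"
      using Poly_Mapping.keys_add[of f g] by auto
  next
    fix c and f :: "('v, 'k) mpol" assume "f \<in> ?S"
    moreover have "Poly_Mapping.keys (scale c f) \<subseteq> Poly_Mapping.keys f"
      by (auto simp: in_keys_iff lookup_scale)
    ultimately show "scale c f \<in> ?S"
      by blast
  qed simp
  moreover have "var ` U \<subseteq> ?S"
    by (auto simp: var_def)
  ultimately have "pol.span (var ` U) \<subseteq> ?S"
    by (rule pol.span_minimal[rotated])
  then show ?thesis
    using assms by blast
qed

lemma lookup_var:
  "Poly_Mapping.lookup (var a :: ('v, 'k::field) mpol) (Poly_Mapping.single b 1) = (if a = b then 1 else 0)"
proof -
  have "Poly_Mapping.single a (1::nat) = Poly_Mapping.single b 1 \<longleftrightarrow> a = b"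
    by (metis lookup_single_eq lookup_single_not_eq one_neq_zero)
  then show ?thesis
    by (simp only: var_def monomial_poly_def lookup_single when_def)
qed

text \<open>
  Distinct variables of \<open>U\<close> have distinct images, so the coefficients of \<open>f\<close> reappear unmixed
  in its image.
\<close>

lemma induced_linear_inj_on_span:
  fixes f :: "('v, 'k::field) mpol"
  assumes A: "finite A" "U \<subseteq> A" and inj: "inj_on \<phi> U"
    and f: "f \<in> pol.span (var ` U)" "induced_linear A \<phi> f = 0"
  shows "f = 0"
proof (rule poly_mapping_eqI)
  fix m
  show "Poly_Mapping.lookup f m = Poly_Mapping.lookup 0 m"
  proof (cases "m \<in> Poly_Mapping.keys f")
    case True
    then obtain a where a: "a \<in> U" "m = Poly_Mapping.single a 1"
      using keys_span_vars[OF f(1)] by blast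
    have zero: "Poly_Mapping.lookup f (Poly_Mapping.single b 1) = 0" if "b \<notin> U" for b
    proof (rule ccontr)
      assume "\<not> ?thesis"
      then have "Poly_Mapping.single b (1::nat) \<in> (\<lambda>a. Poly_Mapping.single a 1) ` U"
        using keys_span_vars[OF f(1)] by (auto simp: in_keys_iff simp del: One_nat_def)
      then show False
        using that by (auto simp del: One_nat_def)
          (metis lookup_single_eq lookup_single_not_eq one_neq_zero)
    qed
    have "0 = Poly_Mapping.lookup (induced_linear A \<phi> f) (Poly_Mapping.single (\<phi> a) 1)"
      by (simp add: f(2))
    also have "\<dots> = (\<Sum>b\<in>A. Poly_Mapping.lookup f (Poly_Mapping.single b 1) * (if \<phi> b = \<phi> a then 1 else 0))"
      unfolding induced_linear_def lookup_sum lookup_scale lookup_var ..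
    also have "\<dots> = (\<Sum>b\<in>A. if b = a then Poly_Mapping.lookup f (Poly_Mapping.single b 1) else 0)"
    proof (rule sum.cong)
      fix b assume "b \<in> A"
      show "Poly_Mapping.lookup f (Poly_Mapping.single b 1) * (if \<phi> b = \<phi> a then 1 else 0)
          = (if b = a then Poly_Mapping.lookup f (Poly_Mapping.single b 1) else 0)"
        using zero[of b] inj_onD[OF inj, of b a] a(1) by (cases "b \<in> U") auto
    qed simp
    also have "\<dots> = Poly_Mapping.lookup f m"
      using A a by auto
    finally show ?thesis by simp
  qed (simp add: in_keys_iff)
qed

theorem theorem5p12:
  fixes n :: nat
    and P :: "'p::order set"
    and R :: "'r::order set"
    and \<phi> :: "nat \<times> 'p \<Rightarrow> 'r"
    and J :: "('p \<Rightarrow> nat) set"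
    and B :: "(nat \<times> 'p, 'k::field) mpol set"
    and bs :: "(nat \<times> 'p, 'k) mpol list"
  assumes "n \<ge> 1"
    and "finite P"
    and "isotone_left_strict_chain_fibers n P R \<phi>"
    and "poset_ideal (Hom_poset P n) (le_on P) J"
    and "B \<subseteq> {var x - var y | x y. x \<in> {1..n} \<times> P \<and> y \<in> {1..n} \<times> P \<and> \<phi> x = \<phi> y}"
    and "pol.independent B"
    and "pol.span B = ker_linear ({1..n} \<times> P) \<phi>"
    and "distinct bs"
    and "set bs = B"
  shows "regular_sequence (poly_ring ({1..n} \<times> P) Quot letterplace n P J)
           (map (\<lambda>b. letterplace n P J +>\<^bsub>poly_ring ({1..n} \<times> P)\<^esub> b) bs)"
proof -
  let ?A = "{1..n} \<times> P"
  interpret comm_subring "polys ?A :: (nat \<times> 'p, 'k) mpol set" by (rule comm_subring_polys)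
  have JH: "J \<subseteq> Hom_poset P n"
    using assms(4) by (simp add: poset_ideal_def)
  have diffs: "set bs \<subseteq> {var x - var y | x y. x \<in> ?A \<and> y \<in> ?A}"
    using assms(5,9) by blast
  have bs: "set bs \<subseteq> polys ?A"
  proof
    fix b assume "b \<in> set bs"
    then obtain x y where "b = var x - var y" "x \<in> ?A" "y \<in> ?A"
      using diffs by blast
    then show "b \<in> polys ?A"
      using diff_mem var_mem_polys by metis
  qed
  have "regular_on (monomial_ideal ?A (\<lambda>m. Poly_Mapping.keys m \<inter> map_graph P \<psi> \<noteq> {})) (rev bs)"
    if \<psi>: "\<psi> \<in> J" for \<psi>
  proof (rule regular_on_differences)
    show U: "map_graph P \<psi> \<subseteq> ?A"
      using JH \<psi> by (auto simp: map_graph_def Hom_poset_def)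
    have "f = 0" if "f \<in> pol.span B" "f \<in> pol.span (var ` map_graph P \<psi>)" for f
    proof (rule induced_linear_inj_on_span[OF _ U])
      show "inj_on \<phi> (map_graph P \<psi>)"
        using assms(3) JH \<psi> by (intro inj_on_graph) auto
      show "induced_linear ?A \<phi> f = 0"
        using that(1) unfolding assms(7) ker_linear_def by blast
    qed (use assms(2) that in auto)
    then show "pol.span (set (rev bs)) \<inter> pol.span (var ` map_graph P \<psi>) = {0}"
      using assms(9) pol.span_zero by auto
  qed (use diffs assms in auto)
  then have "regular_on (monomial_ideal ?A (meets_graphs P J)) (rev bs)"
    using assms(2,4) bs by (intro regular_on_meets_graphs) auto
  moreover have "is_ideal (monomial_ideal ?A (meets_graphs P J) :: (nat \<times> 'p, 'k) mpol set)"
    by (intro is_ideal_monomial_ideal up_closed_meets_graphs)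
  ultimately show ?thesis
    unfolding letterplace_eq[OF assms(2) JH] using bs by (intro regular_sequence_poly_ring)
qed

end
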